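(* (Riesz Representation Theorem for integration structures.) Let $\mathcal M$ be an integration $L$-structure (positive or signed), where $L$ is a signature for integration structures. For every $f\in\mathcal L^\infty_\Omega$, the function $[f]:\Omega\to\mathbb R$, $\omega\mapsto f(\omega)$, is Loeb-integrable (i.e. integrable with respect to the Loeb measure $\mu_{\mathrm L}$ on $(\Omega,\mathcal A_{\mathrm L})$) and $$If=\int[f]\,d\mu_{\mathrm L}.$$
   Context: Metric structures and logic. All metric spaces are assumed complete. A pointed metric space is a metric space $(M,d)$ with a distinguished point $a$, its anchor; $B[r]=\{x:d(x,a)\le r\}$ and $B(r)=\{x:d(x,a)<r\}$. Finite products are pointed by the tuple of anchors and given the supremum metric. A (Henson) metric structure consists of a family of pointed metric spaces, its sorts, one of which is $\mathbb R$ (usual metric, anchor $0$), and a family of functions from finite products of sorts to sorts (arity $0$ functions are constants), each bounded and uniformly continuous on every bounded subset of its domain. The metric and anchor of each sort, the operations $+,-,\cdot,|\cdot|,\max=\vee,\min=\wedge$ of $\mathbb R$ and a constant for each rational are always among the functions. A sort is discrete if its metric takes only the values $0,1$. A signature $L$ is a set of sort indices together with function symbols with specified domain and range sorts; an $L$-structure is a metric structure interpreting them; $\mathrm{card}(L)$ is the number of sorts plus the number of function symbols plus $\aleph_0$. For a set $P$ of elements of $\mathcal M$, $L[P]$ is $L$ with a constant symbol added for each element of $P$. Terms are built from sorted variables and function symbols. Positive bounded $L$-formulas ($L$-formulas) are built from atomic formulas $t\le q$, $t\ge q$ ($t$ a real-valued term, $q$ rational) using $\wedge$, $\vee$ and quantifiers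 $\exists_q x$, $\forall_q x$ ($q$ a positive rational). Discrete satisfaction $\models$ is defined as usual, where $\exists_q x$ ranges over the closed ball $B[q]$ and $\forall_q x$ over the open ball $B(q)$ of the sort of $x$. An approximation of a formula is obtained by strictly relaxing every bound: $t\le q$ becomes $t\le q'$ with $q'>q$, $t\ge q$ becomes $t\ge q'$ with $q'<q$, $\exists_q$ becomes $\exists_{q'}$ with $q'>q$, $\forall_q$ becomes $\forall_{q'}$ with $q'<q$. $\mathcal M$ approximately satisfies $\varphi$ if $\mathcal M\models\varphi'$ for every approximation $\varphi'$ of $\varphi$. For an infinite cardinal $\kappa\le\mathrm{card}(\mathcal M)$ (the sum of the cardinalities of the sorts), $\mathcal M$ is $\kappa$-saturated if, whenever $P$ is a set of fewer than $\kappa$ elements of $\mathcal M$ and $\Phi(x_1,\dots,x_n)$ is a set of $L[P]$-formulas for which there is $r$ such that $\mathcal M$ approximately satisfies $\exists_rx_1\cdots\exists_rx_n\bigwedge\Phi_0$ for every finite $\Phi_0\subseteq\Phi$, there are $c_1,\dots,c_n$ in $\mathcal M$ at which $\mathcal M$ approximately satisfies all formulas of $\Phi$. Loeb signatures and pre-Loeb structures. A Loeb signature has, besides $\mathbb R$, sorts $\Omega$ (with anchor $\omega_0$) and $\mathcal A$ (with anchor $\varnothing$), function symbols $\boldsymbol\mu:\mathcal A\to\mathbb R$, $\cup,\cap:\mathcal A\times\mathcal A\to\mathcal A$, ${}^{\mathrm c}:\mathcal A\to\mathcal A$, $[\![\cdot\in\cdot]\!]:\Omega\times\mathcal A\to\{0,1\}$,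 and constants $\varnothing,\mathtt\Omega$ of sort $\mathcal A$ and $\mathtt c_{\omega_0}$ of sort $\Omega$ (and possibly other sorts and symbols). A pre-Loeb finite measure structure is a structure such that: the sorts $\Omega$ and $\mathcal A$ are discrete; $[\![\cdot\in\cdot]\!]$ is $\{0,1\}$-valued and for all $A,B\in\mathcal A$, $\omega\in\Omega$: $d_{\mathcal A}(A,B)=\sup_{x\in\Omega}|[\![x\in A]\!]-[\![x\in B]\!]|$, $[\![\omega\in\varnothing]\!]=0$, $[\![\omega\in\mathtt\Omega]\!]=1$, $[\![\omega\in A\cup B]\!]=[\![\omega\in A]\!]\vee[\![\omega\in B]\!]$, $[\![\omega\in A\cap B]\!]=[\![\omega\in A]\!]\wedge[\![\omega\in B]\!]$, $[\![\omega\in A]\!]+[\![\omega\in A^{\mathrm c}]\!]=1$; and, with $\mu$ the interpretation of $\boldsymbol\mu$, for some $C\ge0$: $\mu(\varnothing)=0$, $0\le\mu(A)\le\mu(\mathtt\Omega)=:\|\mu\|\le C$ and $\mu(A\cup B)+\mu(A\cap B)=\mu(A)+\mu(B)$ for all $A,B\in\mathcal A$. In a pre-Loeb signed measure structure the conditions on $\mu$ are replaced by: for some $C\ge0$, $\mu(\varnothing)=0$, $\mu(A\cup B)+\mu(A\cap B)=\mu(A)+\mu(B)$ for all $A,B$, and $\|\mu\|:=\sup\{|\mu(A)|+|\mu(B)|-|\mu(A\cap B)|:A,B\in\mathcal A\}\le C$. Integration structures. A signature for integration structures is a Loeb signature with an additional sort $\mathcal L^\infty_\Omega$ and symbols: $\|\cdot\|_{\mathcal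 L^\infty_\Omega},\sup,\inf:\mathcal L^\infty_\Omega\to\mathbb R$; binary operations $+,-,\cdot,\wedge,\vee$ on $\mathcal L^\infty_\Omega$; scalar multiplication $\mathbb R\times\mathcal L^\infty_\Omega\to\mathcal L^\infty_\Omega$; evaluation $\mathrm{ev}_\Omega:\mathcal L^\infty_\Omega\times\Omega\to\mathbb R$ (written $f(\omega)$); $\chi:\mathcal A\to\mathcal L^\infty_\Omega$ (written $\chi_A$); $I:\mathcal L^\infty_\Omega\to\mathbb R$ (written $If$); and constants $0,1$ of sort $\mathcal L^\infty_\Omega$ (and possibly other sorts and symbols). A positive pre-integration structure is a structure $\mathcal M$ such that: $\mathcal L^\infty_\Omega$ with the given operations and norm is a Banach algebra and Banach lattice with anchor $0$; its metric is induced by its norm; for all $f\in\mathcal L^\infty_\Omega$, $\omega\in\Omega$: $\|f\|_{\mathcal L^\infty_\Omega}=\sup_{\omega'\in\Omega}|f(\omega')|$, $\mathrm{ev}_\Omega(\cdot,\omega)$ is an algebra and lattice homomorphism, $\sup f=\sup_{\omega'\in\Omega}f(\omega')$, $\inf f=\inf_{\omega'\in\Omega}f(\omega')$, $0(\omega)=0$, $1(\omega)=1$; each $f\in\mathcal L^\infty_\Omega$ is approximately $\mathcal A$-measurable: for any reals $u<v$ there is $A\in\mathcal A$ such that $f(\omega)\le v$ if $[\![\omega\in A]\!]=1$ and $f(\omega)\ge u$ if $[\![\omega\in A]\!]=0$; $\chi_A(\omega)=[\![\omega\in A]\!]$ for all $A,\omega$; and, for some $C\ge0$, $\mathcal M$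 is a pre-Loeb finite measure structure with $\mu(A)=I\chi_A$ for all $A\in\mathcal A$ and $\|\mu\|=\mu(\mathtt\Omega)\le C$, $I$ is a $\|\mu\|$-Lipschitz linear functional, and $\|\mu\|\inf f\le If\le\|\mu\|\sup f$ for all $f$. In a signed pre-integration structure the last axiom is replaced by: for some $C\ge0$, $\mathcal M$ is a pre-Loeb signed measure structure with $\|\mu\|\le C$ and $\mu(A)=I\chi_A$ for all $A$, $I$ is a $\|\mu\|$-Lipschitz linear functional, and $|If|\le\|\mu\|\,\|f\|_{\mathcal L^\infty_\Omega}$ for all $f$. A positive (signed) integration structure is a $\lambda^+$-saturated positive (signed) pre-integration structure, where $\lambda=\mathrm{card}(L)$. Loeb algebra and Loeb measure. For $A\in\mathcal A$, $[A]=\{\omega\in\Omega^{\mathcal M}:[\![\omega\in A]\!]=1\}$, and $[\mathcal A]=\{[A]:A\in\mathcal A\}$, an algebra of subsets of $\Omega=\Omega^{\mathcal M}$; $A\mapsto[A]$ is an isomorphism of Boolean algebras. The Loeb algebra $\mathcal A_{\mathrm L}$ is the $\sigma$-algebra of subsets of $\Omega$ generated by $[\mathcal A]$, and the Loeb measure $\mu_{\mathrm L}$ is the unique countably additive (positive, resp. signed) measure on $\mathcal A_{\mathrm L}$ of total variation $\|\mu\|$ with $\mu_{\mathrm L}([A])=\mu(A)$ for all $A\in\mathcal A$ (it exists by saturation). *)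

theory Defs
  imports "HOL-Analysis.Analysis"
begin

unbundle cardinal_syntax

section \<open>Metric structures\<close>

text \<open>
  Elements of all sorts of a structure live in one type. The sort of reals consists of the
  elements \<open>Rl x\<close>; the other sorts are arbitrary sets of elements and need not be disjoint.
  Where distinct sorts must not be confused (parameters, cardinality of a structure), an element is
  paired with its sort.
\<close>

datatype 'a elem = Rl (rl: real) | Pt 'a

text \<open>
  A signature is a set of sort indices and a set of function symbols with their domain
  (a list of sorts) and range. The remaining fields name the sort of reals and the symbols that every
  signature contains. Nothing requires differently named symbols to be different.
\<close>

record ('s,'f) signature =
  sorts :: "'s set"
  symbols :: "'f set"
  arg_sorts :: "'f \<Rightarrow> 's list"
  res_sort :: "'f \<Rightarrow> 's"
  real_sort :: 's
  dist_sym :: "'s \<Rightarrow> 'f"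
  anchor_sym :: "'s \<Rightarrow> 'f"
  radd_sym :: 'f
  rsub_sym :: 'f
  rmul_sym :: 'f
  rabs_sym :: 'f
  rmax_sym :: 'f
  rmin_sym :: 'f
  rat_sym :: "rat \<Rightarrow> 'f"

definition has_type :: "('s,'f,'z) signature_scheme \<Rightarrow> 'f \<Rightarrow> 's list \<Rightarrow> 's \<Rightarrow> bool" where
  "has_type L f ss s \<longleftrightarrow> f \<in> symbols L \<and> arg_sorts L f = ss \<and> res_sort L f = s"

definition is_signature :: "('s,'f,'z) signature_scheme \<Rightarrow> bool" where
  "is_signature L \<longleftrightarrow>
     real_sort L \<in> sorts L \<and>
     (\<forall>f\<in>symbols L. set (arg_sorts L f) \<subseteq> sorts L \<and> res_sort L f \<in> sorts L) \<and>
     (\<forall>s\<in>sorts L. has_type L (dist_sym L s) [s, s] (real_sort L) \<and>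
                   has_type L (anchor_sym L s) [] s) \<and>
     (\<forall>f\<in>{radd_sym L, rsub_sym L, rmul_sym L, rmax_sym L, rmin_sym L}.
        has_type L f [real_sort L, real_sort L] (real_sort L)) \<and>
     has_type L (rabs_sym L) [real_sort L] (real_sort L) \<and>
     (\<forall>q. has_type L (rat_sym L q) [] (real_sort L))"

definition card_sig :: "('s,'f,'z) signature_scheme \<Rightarrow> (('s + 'f) + nat) rel" where
  "card_sig L = ( |sorts L| +c |symbols L| ) +c natLeq"

record ('s,'f,'a) metric_structure =
  sort_metric :: "'s \<Rightarrow> 'a elem metric"
  anchor :: "'s \<Rightarrow> 'a elem"
  interp :: "'f \<Rightarrow> 'a elem list \<Rightarrow> 'a elem"

abbreviation univ :: "('s,'f,'a) metric_structure \<Rightarrow> 's \<Rightarrow> 'a elem set" where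
  "univ M s \<equiv> mspace (sort_metric M s)"

abbreviation sdist :: "('s,'f,'a) metric_structure \<Rightarrow> 's \<Rightarrow> 'a elem \<Rightarrow> 'a elem \<Rightarrow> real" where
  "sdist M s \<equiv> mdist (sort_metric M s)"

text \<open>Finite products of sorts, as lists, with the supremum metric (\<open>0\<close> on the empty product).\<close>

definition prod_univ :: "('s,'f,'a) metric_structure \<Rightarrow> 's list \<Rightarrow> 'a elem list set" where
  "prod_univ M ss = {xs. list_all2 (\<lambda>x s. x \<in> univ M s) xs ss}"

definition prod_sdist ::
  "('s,'f,'a) metric_structure \<Rightarrow> 's list \<Rightarrow> 'a elem list \<Rightarrow> 'a elem list \<Rightarrow> real" where
  "prod_sdist M ss xs ys =
     Max (insert 0 {sdist M (ss ! i) (xs ! i) (ys ! i) | i. i < length ss})"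

definition prod_cball :: "('s,'f,'a) metric_structure \<Rightarrow> 's list \<Rightarrow> real \<Rightarrow> 'a elem list set" where
  "prod_cball M ss r = {xs \<in> prod_univ M ss. prod_sdist M ss xs (map (anchor M) ss) \<le> r}"

definition bounded_on_bounded ::
  "('s,'f,'a) metric_structure \<Rightarrow> 's list \<Rightarrow> 's \<Rightarrow> ('a elem list \<Rightarrow> 'a elem) \<Rightarrow> bool" where
  "bounded_on_bounded M ss s F \<longleftrightarrow>
     (\<forall>r. \<exists>C. \<forall>xs\<in>prod_cball M ss r. sdist M s (F xs) (anchor M s) \<le> C)"

definition unif_cont_on_bounded ::
  "('s,'f,'a) metric_structure \<Rightarrow> 's list \<Rightarrow> 's \<Rightarrow> ('a elem list \<Rightarrow> 'a elem) \<Rightarrow> bool" where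
  "unif_cont_on_bounded M ss s F \<longleftrightarrow>
     (\<forall>r. \<forall>\<epsilon>>0. \<exists>\<delta>>0. \<forall>xs\<in>prod_cball M ss r. \<forall>ys\<in>prod_cball M ss r.
        prod_sdist M ss xs ys < \<delta> \<longrightarrow> sdist M s (F xs) (F ys) < \<epsilon>)"

definition is_metric_structure ::
  "('s,'f,'z) signature_scheme \<Rightarrow> ('s,'f,'a) metric_structure \<Rightarrow> bool" where
  "is_metric_structure L M \<longleftrightarrow>
     (\<forall>s\<in>sorts L. mcomplete_of (sort_metric M s) \<and> anchor M s \<in> univ M s) \<and>
     univ M (real_sort L) = range Rl \<and>
     (\<forall>x y. sdist M (real_sort L) (Rl x) (Rl y) = \<bar>x - y\<bar>) \<and>
     anchor M (real_sort L) = Rl 0 \<and>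
     (\<forall>f\<in>symbols L.
        (\<forall>xs\<in>prod_univ M (arg_sorts L f). interp M f xs \<in> univ M (res_sort L f)) \<and>
        bounded_on_bounded M (arg_sorts L f) (res_sort L f) (interp M f) \<and>
        unif_cont_on_bounded M (arg_sorts L f) (res_sort L f) (interp M f)) \<and>
     (\<forall>s\<in>sorts L. (\<forall>x\<in>univ M s. \<forall>y\<in>univ M s. interp M (dist_sym L s) [x, y] = Rl (sdist M s x y)) \<and>
                   interp M (anchor_sym L s) [] = anchor M s) \<and>
     (\<forall>x y. interp M (radd_sym L) [Rl x, Rl y] = Rl (x + y) \<and>
            interp M (rsub_sym L) [Rl x, Rl y] = Rl (x - y) \<and>
            interp M (rmul_sym L) [Rl x, Rl y] = Rl (x * y) \<and>
            interp M (rabs_sym L) [Rl x] = Rl \<bar>x\<bar> \<and>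
            interp M (rmax_sym L) [Rl x, Rl y] = Rl (max x y) \<and>
            interp M (rmin_sym L) [Rl x, Rl y] = Rl (min x y)) \<and>
     (\<forall>q. interp M (rat_sym L q) [] = Rl (of_rat q))"

definition elements ::
  "('s,'f,'z) signature_scheme \<Rightarrow> ('s,'f,'a) metric_structure \<Rightarrow> ('s \<times> 'a elem) set" where
  "elements L M = Sigma (sorts L) (univ M)"

definition discrete_sort :: "('s,'f,'a) metric_structure \<Rightarrow> 's \<Rightarrow> bool" where
  "discrete_sort M s \<longleftrightarrow> (\<forall>x\<in>univ M s. \<forall>y\<in>univ M s. sdist M s x y \<in> {0, 1})"


section \<open>Positive bounded formulas, approximate satisfaction, saturation\<close>

text \<open>The variables of sort \<open>s\<close> are \<open>(s, n)\<close> for natural numbers \<open>n\<close>.\<close>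

datatype ('s,'f) tm = Var "'s \<times> nat" | App 'f "('s,'f) tm list"

inductive has_sort :: "('s,'f,'z) signature_scheme \<Rightarrow> ('s,'f) tm \<Rightarrow> 's \<Rightarrow> bool" for L where
  "s \<in> sorts L \<Longrightarrow> has_sort L (Var (s, n)) s"
| "f \<in> symbols L \<Longrightarrow> list_all2 (has_sort L) ts (arg_sorts L f) \<Longrightarrow>
     has_sort L (App f ts) (res_sort L f)"

primrec tm_vars :: "('s,'f) tm \<Rightarrow> ('s \<times> nat) set" where
  "tm_vars (Var v) = {v}"
| "tm_vars (App f ts) = \<Union> (set (map tm_vars ts))"

datatype ('s,'f) fm =
    Le "('s,'f) tm" rat
  | Ge "('s,'f) tm" rat
  | Conj "('s,'f) fm" "('s,'f) fm"
  | Disj "('s,'f) fm" "('s,'f) fm"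
  | Exi rat "'s \<times> nat" "('s,'f) fm"
  | Uni rat "'s \<times> nat" "('s,'f) fm"

primrec is_formula :: "('s,'f,'z) signature_scheme \<Rightarrow> ('s,'f) fm \<Rightarrow> bool" where
  "is_formula L (Le t q) \<longleftrightarrow> has_sort L t (real_sort L)"
| "is_formula L (Ge t q) \<longleftrightarrow> has_sort L t (real_sort L)"
| "is_formula L (Conj \<phi> \<psi>) \<longleftrightarrow> is_formula L \<phi> \<and> is_formula L \<psi>"
| "is_formula L (Disj \<phi> \<psi>) \<longleftrightarrow> is_formula L \<phi> \<and> is_formula L \<psi>"
| "is_formula L (Exi q v \<phi>) \<longleftrightarrow> 0 < q \<and> fst v \<in> sorts L \<and> is_formula L \<phi>"
| "is_formula L (Uni q v \<phi>) \<longleftrightarrow> 0 < q \<and> fst v \<in> sorts L \<and> is_formula L \<phi>"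

primrec free_vars :: "('s,'f) fm \<Rightarrow> ('s \<times> nat) set" where
  "free_vars (Le t q) = tm_vars t"
| "free_vars (Ge t q) = tm_vars t"
| "free_vars (Conj \<phi> \<psi>) = free_vars \<phi> \<union> free_vars \<psi>"
| "free_vars (Disj \<phi> \<psi>) = free_vars \<phi> \<union> free_vars \<psi>"
| "free_vars (Exi q v \<phi>) = free_vars \<phi> - {v}"
| "free_vars (Uni q v \<phi>) = free_vars \<phi> - {v}"

definition valuation ::
  "('s,'f,'z) signature_scheme \<Rightarrow> ('s,'f,'a) metric_structure \<Rightarrow> ('s \<times> nat \<Rightarrow> 'a elem) \<Rightarrow> bool" where
  "valuation L M e \<longleftrightarrow> (\<forall>s\<in>sorts L. \<forall>n. e (s, n) \<in> univ M s)"

primrec eval_tm ::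
  "('s,'f,'a) metric_structure \<Rightarrow> ('s \<times> nat \<Rightarrow> 'a elem) \<Rightarrow> ('s,'f) tm \<Rightarrow> 'a elem" where
  "eval_tm M e (Var v) = e v"
| "eval_tm M e (App f ts) = interp M f (map (eval_tm M e) ts)"

primrec sat ::
  "('s,'f,'a) metric_structure \<Rightarrow> ('s \<times> nat \<Rightarrow> 'a elem) \<Rightarrow> ('s,'f) fm \<Rightarrow> bool" where
  "sat M e (Le t q) \<longleftrightarrow> rl (eval_tm M e t) \<le> of_rat q"
| "sat M e (Ge t q) \<longleftrightarrow> rl (eval_tm M e t) \<ge> of_rat q"
| "sat M e (Conj \<phi> \<psi>) \<longleftrightarrow> sat M e \<phi> \<and> sat M e \<psi>"
| "sat M e (Disj \<phi> \<psi>) \<longleftrightarrow> sat M e \<phi> \<or> sat M e \<psi>"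
| "sat M e (Exi q v \<phi>) \<longleftrightarrow>
     (\<exists>x\<in>mcball_of (sort_metric M (fst v)) (anchor M (fst v)) (of_rat q). sat M (e(v := x)) \<phi>)"
| "sat M e (Uni q v \<phi>) \<longleftrightarrow>
     (\<forall>x\<in>mball_of (sort_metric M (fst v)) (anchor M (fst v)) (of_rat q). sat M (e(v := x)) \<phi>)"

inductive approximation :: "('s,'f) fm \<Rightarrow> ('s,'f) fm \<Rightarrow> bool" where
  "q < q' \<Longrightarrow> approximation (Le t q) (Le t q')"
| "q' < q \<Longrightarrow> approximation (Ge t q) (Ge t q')"
| "approximation \<phi> \<phi>' \<Longrightarrow> approximation \<psi> \<psi>' \<Longrightarrow> approximation (Conj \<phi> \<psi>) (Conj \<phi>' \<psi>')"
| "approximation \<phi> \<phi>' \<Longrightarrow> approximation \<psi> \<psi>' \<Longrightarrow> approximation (Disj \<phi> \<psi>) (Disj \<phi>' \<psi>')"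
| "q < q' \<Longrightarrow> approximation \<phi> \<phi>' \<Longrightarrow> approximation (Exi q v \<phi>) (Exi q' v \<phi>')"
| "0 < q' \<Longrightarrow> q' < q \<Longrightarrow> approximation \<phi> \<phi>' \<Longrightarrow> approximation (Uni q v \<phi>) (Uni q' v \<phi>')"

definition approx_sat ::
  "('s,'f,'a) metric_structure \<Rightarrow> ('s \<times> nat \<Rightarrow> 'a elem) \<Rightarrow> ('s,'f) fm \<Rightarrow> bool" where
  "approx_sat M e \<phi> \<longleftrightarrow> (\<forall>\<phi>'. approximation \<phi> \<phi>' \<longrightarrow> sat M e \<phi>')"

text \<open>
  \<open>with_params L P\<close> is $L[P]$. Its symbols are those of \<open>L\<close> (tagged \<open>Inl\<close>) and one constant
  \<open>Inr p\<close> for each \<open>p \<in> P\<close>, where \<open>p\<close> is an element together with its sort. \<open>expand M\<close> is \<open>M\<close> with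
  these constants interpreted by the elements they name.
\<close>

definition with_params ::
  "('s,'f,'z) signature_scheme \<Rightarrow> ('s \<times> 'a elem) set \<Rightarrow> ('s, 'f + 's \<times> 'a elem) signature" where
  "with_params L P =
     \<lparr> sorts = sorts L,
       symbols = Inl ` symbols L \<union> Inr ` P,
       arg_sorts = case_sum (arg_sorts L) (\<lambda>_. []),
       res_sort = case_sum (res_sort L) fst,
       real_sort = real_sort L,
       dist_sym = (\<lambda>s. Inl (dist_sym L s)),
       anchor_sym = (\<lambda>s. Inl (anchor_sym L s)),
       radd_sym = Inl (radd_sym L),
       rsub_sym = Inl (rsub_sym L),
       rmul_sym = Inl (rmul_sym L),
       rabs_sym = Inl (rabs_sym L),
       rmax_sym = Inl (rmax_sym L),
       rmin_sym = Inl (rmin_sym L),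
       rat_sym = (\<lambda>q. Inl (rat_sym L q)) \<rparr>"

definition expand ::
  "('s,'f,'a) metric_structure \<Rightarrow> ('s, 'f + 's \<times> 'a elem, 'a) metric_structure" where
  "expand M =
     \<lparr> sort_metric = sort_metric M,
       anchor = anchor M,
       interp = case_sum (interp M) (\<lambda>p _. snd p) \<rparr>"

fun conj_list :: "('s,'f) fm list \<Rightarrow> ('s,'f) fm" where
  "conj_list [\<phi>] = \<phi>"
| "conj_list (\<phi> # \<phi>s) = Conj \<phi> (conj_list \<phi>s)"

definition exists_list :: "rat \<Rightarrow> ('s \<times> nat) list \<Rightarrow> ('s,'f) fm \<Rightarrow> ('s,'f) fm" where
  "exists_list r vs \<phi> = foldr (Exi r) vs \<phi>"

text \<open>
  The finite subsets of \<open>\<Phi>\<close> are given by nonempty lists \<open>\<phi>s\<close>, so that their conjunction is a formula.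
  The formula \<open>exists_list r vs (conj_list \<phi>s)\<close> is a sentence, so its truth does not depend on \<open>e\<close>.
\<close>

definition saturated ::
  "('s,'f,'z) signature_scheme \<Rightarrow> ('s,'f,'a) metric_structure \<Rightarrow> 'k rel \<Rightarrow> bool" where
  "saturated L M \<kappa> \<longleftrightarrow>
     Card_order \<kappa> \<and> cinfinite \<kappa> \<and> \<kappa> \<le>o |elements L M| \<and>
     (\<forall>P vs \<Phi>.
        P \<subseteq> elements L M \<longrightarrow> |P| <o \<kappa> \<longrightarrow>
        distinct vs \<longrightarrow> fst ` set vs \<subseteq> sorts L \<longrightarrow>
        (\<forall>\<phi>\<in>\<Phi>. is_formula (with_params L P) \<phi> \<and> free_vars \<phi> \<subseteq> set vs) \<longrightarrow>
        (\<exists>r>0. \<forall>\<phi>s. \<phi>s \<noteq> [] \<longrightarrow> set \<phi>s \<subseteq> \<Phi> \<longrightarrow>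
           (\<forall>e. valuation L M e \<longrightarrow> approx_sat (expand M) e (exists_list r vs (conj_list \<phi>s)))) \<longrightarrow>
        (\<exists>c. valuation L M c \<and> (\<forall>\<phi>\<in>\<Phi>. approx_sat (expand M) c \<phi>)))"


section \<open>Pre-Loeb structures\<close>

record ('s,'f) loeb_signature = "('s,'f) signature" +
  Omega_sort :: 's
  Alg_sort :: 's
  mu_sym :: 'f
  cup_sym :: 'f
  cap_sym :: 'f
  compl_sym :: 'f
  mem_sym :: 'f
  empty_sym :: 'f
  full_sym :: 'f
  omega0_sym :: 'f

text \<open>
  The symbol $[\![\cdot\in\cdot]\!]$ is real-valued; that its values are \<open>0\<close> and \<open>1\<close> is an axiom of
  pre-Loeb structures.
\<close>

definition is_loeb_signature :: "('s,'f,'z) loeb_signature_scheme \<Rightarrow> bool" where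
  "is_loeb_signature L \<longleftrightarrow>
     is_signature L \<and>
     {Omega_sort L, Alg_sort L} \<subseteq> sorts L \<and>
     distinct [real_sort L, Omega_sort L, Alg_sort L] \<and>
     has_type L (mu_sym L) [Alg_sort L] (real_sort L) \<and>
     has_type L (cup_sym L) [Alg_sort L, Alg_sort L] (Alg_sort L) \<and>
     has_type L (cap_sym L) [Alg_sort L, Alg_sort L] (Alg_sort L) \<and>
     has_type L (compl_sym L) [Alg_sort L] (Alg_sort L) \<and>
     has_type L (mem_sym L) [Omega_sort L, Alg_sort L] (real_sort L) \<and>
     has_type L (empty_sym L) [] (Alg_sort L) \<and>
     has_type L (full_sym L) [] (Alg_sort L) \<and>
     has_type L (omega0_sym L) [] (Omega_sort L)"

context
  fixes L :: "('s,'f,'z) loeb_signature_scheme" and M :: "('s,'f,'a) metric_structure"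
begin

definition Om :: "'a elem set" where "Om = univ M (Omega_sort L)"
definition Alg :: "'a elem set" where "Alg = univ M (Alg_sort L)"
definition mu :: "'a elem \<Rightarrow> real" where "mu A = rl (interp M (mu_sym L) [A])"
definition cup :: "'a elem \<Rightarrow> 'a elem \<Rightarrow> 'a elem" where "cup A B = interp M (cup_sym L) [A, B]"
definition cap :: "'a elem \<Rightarrow> 'a elem \<Rightarrow> 'a elem" where "cap A B = interp M (cap_sym L) [A, B]"
definition compl :: "'a elem \<Rightarrow> 'a elem" where "compl A = interp M (compl_sym L) [A]"
definition mem :: "'a elem \<Rightarrow> 'a elem \<Rightarrow> real" where "mem \<omega> A = rl (interp M (mem_sym L) [\<omega>, A])"
definition empty_alg :: "'a elem" where "empty_alg = interp M (empty_sym L) []"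
definition full_alg :: "'a elem" where "full_alg = interp M (full_sym L) []"

definition pre_loeb_base :: bool where
  "pre_loeb_base \<longleftrightarrow>
     is_metric_structure L M \<and>
     interp M (omega0_sym L) [] = anchor M (Omega_sort L) \<and>
     empty_alg = anchor M (Alg_sort L) \<and>
     discrete_sort M (Omega_sort L) \<and> discrete_sort M (Alg_sort L) \<and>
     (\<forall>\<omega>\<in>Om. \<forall>A\<in>Alg. mem \<omega> A \<in> {0, 1}) \<and>
     (\<forall>A\<in>Alg. \<forall>B\<in>Alg. sdist M (Alg_sort L) A B = (SUP x\<in>Om. \<bar>mem x A - mem x B\<bar>)) \<and>
     (\<forall>\<omega>\<in>Om. mem \<omega> empty_alg = 0 \<and> mem \<omega> full_alg = 1) \<and>
     (\<forall>\<omega>\<in>Om. \<forall>A\<in>Alg. \<forall>B\<in>Alg.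
        mem \<omega> (cup A B) = max (mem \<omega> A) (mem \<omega> B) \<and>
        mem \<omega> (cap A B) = min (mem \<omega> A) (mem \<omega> B)) \<and>
     (\<forall>\<omega>\<in>Om. \<forall>A\<in>Alg. mem \<omega> A + mem \<omega> (compl A) = 1)"

definition mu_additive :: bool where
  "mu_additive \<longleftrightarrow>
     mu empty_alg = 0 \<and> (\<forall>A\<in>Alg. \<forall>B\<in>Alg. mu (cup A B) + mu (cap A B) = mu A + mu B)"

definition pos_norm :: real where "pos_norm = mu full_alg"

definition pre_loeb_finite_measure :: bool where
  "pre_loeb_finite_measure \<longleftrightarrow>
     pre_loeb_base \<and> mu_additive \<and>
     (\<exists>C\<ge>0. \<forall>A\<in>Alg. 0 \<le> mu A \<and> mu A \<le> pos_norm \<and> pos_norm \<le> C)"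

definition signed_norm_set :: "real set" where
  "signed_norm_set = {\<bar>mu A\<bar> + \<bar>mu B\<bar> - \<bar>mu (cap A B)\<bar> | A B. A \<in> Alg \<and> B \<in> Alg}"

definition signed_norm :: real where "signed_norm = Sup signed_norm_set"

definition pre_loeb_signed_measure :: bool where
  "pre_loeb_signed_measure \<longleftrightarrow>
     pre_loeb_base \<and> mu_additive \<and>
     (\<exists>C\<ge>0. bdd_above signed_norm_set \<and> signed_norm \<le> C)"

end


section \<open>Banach algebras and Banach lattices on a carrier set\<close>

text \<open>
  The carrier is the metric space \<open>m\<close>, whose metric is required to be induced by the norm.
  The algebra is unital.
\<close>

definition banach_space_on ::
  "'v metric \<Rightarrow> ('v \<Rightarrow> 'v \<Rightarrow> 'v) \<Rightarrow> ('v \<Rightarrow> 'v \<Rightarrow> 'v) \<Rightarrow> (real \<Rightarrow> 'v \<Rightarrow> 'v) \<Rightarrow> 'v \<Rightarrow> ('v \<Rightarrow> real) \<Rightarrow> bool"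
where
  "banach_space_on m add sub scl zer nrm \<longleftrightarrow>
     (let V = mspace m in
      zer \<in> V \<and>
      (\<forall>x\<in>V. \<forall>y\<in>V. add x y \<in> V \<and> sub x y \<in> V) \<and> (\<forall>a. \<forall>x\<in>V. scl a x \<in> V) \<and>
      (\<forall>x\<in>V. \<forall>y\<in>V. \<forall>z\<in>V. add (add x y) z = add x (add y z)) \<and>
      (\<forall>x\<in>V. \<forall>y\<in>V. add x y = add y x) \<and>
      (\<forall>x\<in>V. add zer x = x) \<and>
      (\<forall>x\<in>V. \<forall>y\<in>V. add (sub x y) y = x) \<and>
      (\<forall>a. \<forall>x\<in>V. \<forall>y\<in>V. scl a (add x y) = add (scl a x) (scl a y)) \<and>
      (\<forall>a b. \<forall>x\<in>V. scl (a + b) x = add (scl a x) (scl b x) \<and> scl (a * b) x = scl a (scl b x)) \<and>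
      (\<forall>x\<in>V. scl 1 x = x) \<and>
      (\<forall>x\<in>V. 0 \<le> nrm x \<and> (nrm x = 0 \<longleftrightarrow> x = zer)) \<and>
      (\<forall>x\<in>V. \<forall>y\<in>V. nrm (add x y) \<le> nrm x + nrm y) \<and>
      (\<forall>a. \<forall>x\<in>V. nrm (scl a x) = \<bar>a\<bar> * nrm x) \<and>
      (\<forall>x\<in>V. \<forall>y\<in>V. mdist m x y = nrm (sub x y)) \<and>
      mcomplete_of m)"

definition banach_algebra_on ::
  "'v metric \<Rightarrow> ('v \<Rightarrow> 'v \<Rightarrow> 'v) \<Rightarrow> ('v \<Rightarrow> 'v \<Rightarrow> 'v) \<Rightarrow> ('v \<Rightarrow> 'v \<Rightarrow> 'v) \<Rightarrow> (real \<Rightarrow> 'v \<Rightarrow> 'v) \<Rightarrow>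
   'v \<Rightarrow> 'v \<Rightarrow> ('v \<Rightarrow> real) \<Rightarrow> bool"
where
  "banach_algebra_on m add sub mul scl zer one nrm \<longleftrightarrow>
     banach_space_on m add sub scl zer nrm \<and>
     (let V = mspace m in
      one \<in> V \<and>
      (\<forall>x\<in>V. \<forall>y\<in>V. mul x y \<in> V) \<and>
      (\<forall>x\<in>V. \<forall>y\<in>V. \<forall>z\<in>V. mul (mul x y) z = mul x (mul y z) \<and>
         mul (add x y) z = add (mul x z) (mul y z) \<and>
         mul x (add y z) = add (mul x y) (mul x z)) \<and>
      (\<forall>a. \<forall>x\<in>V. \<forall>y\<in>V. mul (scl a x) y = scl a (mul x y) \<and> mul x (scl a y) = scl a (mul x y)) \<and>
      (\<forall>x\<in>V. mul one x = x \<and> mul x one = x) \<and>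
      (\<forall>x\<in>V. \<forall>y\<in>V. nrm (mul x y) \<le> nrm x * nrm y))"

text \<open>
  The order of a Banach lattice is the one of its lattice operations, \<open>x \<le> y\<close> iff
  \<open>meet x y = x\<close>, and \<open>\<bar>x\<bar>\<close> is \<open>join x (- x)\<close>.
\<close>

definition banach_lattice_on ::
  "'v metric \<Rightarrow> ('v \<Rightarrow> 'v \<Rightarrow> 'v) \<Rightarrow> ('v \<Rightarrow> 'v \<Rightarrow> 'v) \<Rightarrow> (real \<Rightarrow> 'v \<Rightarrow> 'v) \<Rightarrow>
   ('v \<Rightarrow> 'v \<Rightarrow> 'v) \<Rightarrow> ('v \<Rightarrow> 'v \<Rightarrow> 'v) \<Rightarrow> 'v \<Rightarrow> ('v \<Rightarrow> real) \<Rightarrow> bool"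
where
  "banach_lattice_on m add sub scl meet join zer nrm \<longleftrightarrow>
     banach_space_on m add sub scl zer nrm \<and>
     (let V = mspace m; le = (\<lambda>x y. meet x y = x); ab = (\<lambda>x. join x (sub zer x)) in
      (\<forall>x\<in>V. \<forall>y\<in>V. meet x y \<in> V \<and> join x y \<in> V) \<and>
      (\<forall>x\<in>V. \<forall>y\<in>V. meet x y = meet y x \<and> join x y = join y x) \<and>
      (\<forall>x\<in>V. \<forall>y\<in>V. \<forall>z\<in>V. meet (meet x y) z = meet x (meet y z) \<and>
         join (join x y) z = join x (join y z)) \<and>
      (\<forall>x\<in>V. \<forall>y\<in>V. meet x (join x y) = x \<and> join x (meet x y) = x) \<and>
      (\<forall>x\<in>V. \<forall>y\<in>V. \<forall>z\<in>V. le x y \<longrightarrow> le (add x z) (add y z)) \<and>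
      (\<forall>a\<ge>0. \<forall>x\<in>V. le zer x \<longrightarrow> le zer (scl a x)) \<and>
      (\<forall>x\<in>V. \<forall>y\<in>V. le (ab x) (ab y) \<longrightarrow> nrm x \<le> nrm y))"


section \<open>Integration structures\<close>

record ('s,'f) integration_signature = "('s,'f) loeb_signature" +
  Linf_sort :: 's
  lnorm_sym :: 'f
  lsup_sym :: 'f
  linf_sym :: 'f
  ladd_sym :: 'f
  lsub_sym :: 'f
  lmul_sym :: 'f
  lmeet_sym :: 'f
  ljoin_sym :: 'f
  lscale_sym :: 'f
  ev_sym :: 'f
  chi_sym :: 'f
  I_sym :: 'f
  lzero_sym :: 'f
  lone_sym :: 'f

definition is_integration_signature :: "('s,'f,'z) integration_signature_scheme \<Rightarrow> bool" where
  "is_integration_signature L \<longleftrightarrow>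
     is_loeb_signature L \<and>
     Linf_sort L \<in> sorts L \<and> Linf_sort L \<notin> {real_sort L, Omega_sort L, Alg_sort L} \<and>
     (\<forall>f\<in>{lnorm_sym L, lsup_sym L, linf_sym L, I_sym L}. has_type L f [Linf_sort L] (real_sort L)) \<and>
     (\<forall>f\<in>{ladd_sym L, lsub_sym L, lmul_sym L, lmeet_sym L, ljoin_sym L}.
        has_type L f [Linf_sort L, Linf_sort L] (Linf_sort L)) \<and>
     has_type L (lscale_sym L) [real_sort L, Linf_sort L] (Linf_sort L) \<and>
     has_type L (ev_sym L) [Linf_sort L, Omega_sort L] (real_sort L) \<and>
     has_type L (chi_sym L) [Alg_sort L] (Linf_sort L) \<and>
     has_type L (lzero_sym L) [] (Linf_sort L) \<and>
     has_type L (lone_sym L) [] (Linf_sort L)"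

context
  fixes L :: "('s,'f,'z) integration_signature_scheme" and M :: "('s,'f,'a) metric_structure"
begin

definition Linf :: "'a elem set" where "Linf = univ M (Linf_sort L)"
definition lnorm :: "'a elem \<Rightarrow> real" where "lnorm f = rl (interp M (lnorm_sym L) [f])"
definition lsup :: "'a elem \<Rightarrow> real" where "lsup f = rl (interp M (lsup_sym L) [f])"
definition linf :: "'a elem \<Rightarrow> real" where "linf f = rl (interp M (linf_sym L) [f])"
definition ladd :: "'a elem \<Rightarrow> 'a elem \<Rightarrow> 'a elem" where "ladd f g = interp M (ladd_sym L) [f, g]"
definition lsub :: "'a elem \<Rightarrow> 'a elem \<Rightarrow> 'a elem" where "lsub f g = interp M (lsub_sym L) [f, g]"
definition lmul :: "'a elem \<Rightarrow> 'a elem \<Rightarrow> 'a elem" where "lmul f g = interp M (lmul_sym L) [f, g]"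
definition lmeet :: "'a elem \<Rightarrow> 'a elem \<Rightarrow> 'a elem" where "lmeet f g = interp M (lmeet_sym L) [f, g]"
definition ljoin :: "'a elem \<Rightarrow> 'a elem \<Rightarrow> 'a elem" where "ljoin f g = interp M (ljoin_sym L) [f, g]"
definition lscale :: "real \<Rightarrow> 'a elem \<Rightarrow> 'a elem" where "lscale a f = interp M (lscale_sym L) [Rl a, f]"
definition ev :: "'a elem \<Rightarrow> 'a elem \<Rightarrow> real" where "ev f \<omega> = rl (interp M (ev_sym L) [f, \<omega>])"
definition chi :: "'a elem \<Rightarrow> 'a elem" where "chi A = interp M (chi_sym L) [A]"
definition Ifun :: "'a elem \<Rightarrow> real" where "Ifun f = rl (interp M (I_sym L) [f])"
definition lzero :: "'a elem" where "lzero = interp M (lzero_sym L) []"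
definition lone :: "'a elem" where "lone = interp M (lone_sym L) []"

definition pre_integration_base :: bool where
  "pre_integration_base \<longleftrightarrow>
     is_metric_structure L M \<and>
     banach_algebra_on (sort_metric M (Linf_sort L)) ladd lsub lmul lscale lzero lone lnorm \<and>
     banach_lattice_on (sort_metric M (Linf_sort L)) ladd lsub lscale lmeet ljoin lzero lnorm \<and>
     anchor M (Linf_sort L) = lzero \<and>
     (\<forall>f\<in>Linf. bdd_above (ev f ` Om L M) \<and> bdd_below (ev f ` Om L M) \<and>
        lnorm f = (SUP \<omega>\<in>Om L M. \<bar>ev f \<omega>\<bar>) \<and>
        lsup f = (SUP \<omega>\<in>Om L M. ev f \<omega>) \<and>
        linf f = (INF \<omega>\<in>Om L M. ev f \<omega>)) \<and>
     (\<forall>\<omega>\<in>Om L M. \<forall>f\<in>Linf. \<forall>g\<in>Linf.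
        ev (ladd f g) \<omega> = ev f \<omega> + ev g \<omega> \<and>
        ev (lsub f g) \<omega> = ev f \<omega> - ev g \<omega> \<and>
        ev (lmul f g) \<omega> = ev f \<omega> * ev g \<omega> \<and>
        ev (lmeet f g) \<omega> = min (ev f \<omega>) (ev g \<omega>) \<and>
        ev (ljoin f g) \<omega> = max (ev f \<omega>) (ev g \<omega>)) \<and>
     (\<forall>\<omega>\<in>Om L M. \<forall>a. \<forall>f\<in>Linf. ev (lscale a f) \<omega> = a * ev f \<omega>) \<and>
     (\<forall>\<omega>\<in>Om L M. ev lzero \<omega> = 0 \<and> ev lone \<omega> = 1) \<and>
     (\<forall>f\<in>Linf. \<forall>u v. u < v \<longrightarrow>
        (\<exists>A\<in>Alg L M. \<forall>\<omega>\<in>Om L M.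
           (mem L M \<omega> A = 1 \<longrightarrow> ev f \<omega> \<le> v) \<and> (mem L M \<omega> A = 0 \<longrightarrow> u \<le> ev f \<omega>))) \<and>
     (\<forall>A\<in>Alg L M. \<forall>\<omega>\<in>Om L M. ev (chi A) \<omega> = mem L M \<omega> A)"

definition lipschitz_linear_functional :: "real \<Rightarrow> bool" where
  "lipschitz_linear_functional K \<longleftrightarrow>
     (\<forall>f\<in>Linf. \<forall>g\<in>Linf. Ifun (ladd f g) = Ifun f + Ifun g) \<and>
     (\<forall>a. \<forall>f\<in>Linf. Ifun (lscale a f) = a * Ifun f) \<and>
     (\<forall>f\<in>Linf. \<forall>g\<in>Linf. \<bar>Ifun f - Ifun g\<bar> \<le> K * sdist M (Linf_sort L) f g)"

definition positive_pre_integration_structure :: bool where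
  "positive_pre_integration_structure \<longleftrightarrow>
     pre_integration_base \<and>
     (\<exists>C\<ge>0. pre_loeb_finite_measure L M \<and>
        (\<forall>A\<in>Alg L M. mu L M A = Ifun (chi A)) \<and>
        pos_norm L M \<le> C \<and>
        lipschitz_linear_functional (pos_norm L M) \<and>
        (\<forall>f\<in>Linf. pos_norm L M * linf f \<le> Ifun f \<and> Ifun f \<le> pos_norm L M * lsup f))"

definition signed_pre_integration_structure :: bool where
  "signed_pre_integration_structure \<longleftrightarrow>
     pre_integration_base \<and>
     (\<exists>C\<ge>0. pre_loeb_signed_measure L M \<and> signed_norm L M \<le> C \<and>
        (\<forall>A\<in>Alg L M. mu L M A = Ifun (chi A)) \<and>
        lipschitz_linear_functional (signed_norm L M) \<and>
        (\<forall>f\<in>Linf. \<bar>Ifun f\<bar> \<le> signed_norm L M * lnorm f))"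

definition positive_integration_structure :: bool where
  "positive_integration_structure \<longleftrightarrow>
     positive_pre_integration_structure \<and> saturated L M (cardSuc (card_sig L))"

definition signed_integration_structure :: bool where
  "signed_integration_structure \<longleftrightarrow>
     signed_pre_integration_structure \<and> saturated L M (cardSuc (card_sig L))"

end


section \<open>Finite signed measures and integration\<close>

text \<open>
  A finite signed measure on the \<open>\<sigma>\<close>-algebra \<open>\<Sigma>\<close> of subsets of \<open>X\<close> is a real set function. It is
  normalized to vanish outside \<open>\<Sigma>\<close>, so that it is determined by its values on \<open>\<Sigma>\<close>.
\<close>

definition is_signed_measure :: "'a set \<Rightarrow> 'a set set \<Rightarrow> ('a set \<Rightarrow> real) \<Rightarrow> bool" where
  "is_signed_measure X \<Sigma> \<nu> \<longleftrightarrow>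
     sigma_algebra X \<Sigma> \<and> \<nu> {} = 0 \<and>
     (\<forall>E::nat \<Rightarrow> 'a set. range E \<subseteq> \<Sigma> \<longrightarrow> disjoint_family E \<longrightarrow> (\<lambda>n. \<nu> (E n)) sums \<nu> (\<Union>n. E n)) \<and>
     (\<forall>E. E \<notin> \<Sigma> \<longrightarrow> \<nu> E = 0)"

definition total_variation :: "'a set \<Rightarrow> 'a set set \<Rightarrow> ('a set \<Rightarrow> real) \<Rightarrow> ennreal" where
  "total_variation X \<Sigma> \<nu> =
     (SUP P\<in>{P. finite P \<and> P \<subseteq> \<Sigma> \<and> disjoint P \<and> \<Union> P = X}. \<Sum>E\<in>P. ennreal \<bar>\<nu> E\<bar>)"

text \<open>
  The Jordan decomposition: \<open>jordan_pos\<close> is the positive part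
  $\nu^+(E) = \sup\{\nu(F) : F \subseteq E\}$, and the negative part is the positive part of $-\nu$.
\<close>

definition jordan_pos :: "'a set \<Rightarrow> 'a set set \<Rightarrow> ('a set \<Rightarrow> real) \<Rightarrow> 'a measure" where
  "jordan_pos X \<Sigma> \<nu> = measure_of X \<Sigma> (\<lambda>E. SUP F\<in>{F\<in>\<Sigma>. F \<subseteq> E}. ennreal (\<nu> F))"

definition jordan_neg :: "'a set \<Rightarrow> 'a set set \<Rightarrow> ('a set \<Rightarrow> real) \<Rightarrow> 'a measure" where
  "jordan_neg X \<Sigma> \<nu> = jordan_pos X \<Sigma> (\<lambda>E. - \<nu> E)"

definition signed_integrable ::
  "'a set \<Rightarrow> 'a set set \<Rightarrow> ('a set \<Rightarrow> real) \<Rightarrow> ('a \<Rightarrow> real) \<Rightarrow> bool" where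
  "signed_integrable X \<Sigma> \<nu> g \<longleftrightarrow> integrable (jordan_pos X \<Sigma> \<nu>) g \<and> integrable (jordan_neg X \<Sigma> \<nu>) g"

definition signed_integral ::
  "'a set \<Rightarrow> 'a set set \<Rightarrow> ('a set \<Rightarrow> real) \<Rightarrow> ('a \<Rightarrow> real) \<Rightarrow> real" where
  "signed_integral X \<Sigma> \<nu> g =
     integral\<^sup>L (jordan_pos X \<Sigma> \<nu>) g - integral\<^sup>L (jordan_neg X \<Sigma> \<nu>) g"


section \<open>The Loeb algebra and the Loeb measure\<close>

context
  fixes L :: "('s,'f,'z) loeb_signature_scheme" and M :: "('s,'f,'a) metric_structure"
begin

definition loeb_set :: "'a elem \<Rightarrow> 'a elem set" where
  "loeb_set A = {\<omega> \<in> Om L M. mem L M \<omega> A = 1}"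

definition loeb_algebra :: "'a elem set set" where
  "loeb_algebra = sigma_sets (Om L M) (loeb_set ` Alg L M)"

text \<open>The total variation of a positive measure is its total mass.\<close>

definition is_pos_loeb_measure :: "'a elem measure \<Rightarrow> bool" where
  "is_pos_loeb_measure N \<longleftrightarrow>
     space N = Om L M \<and> sets N = loeb_algebra \<and>
     emeasure N (Om L M) = ennreal (pos_norm L M) \<and>
     (\<forall>A\<in>Alg L M. emeasure N (loeb_set A) = ennreal (mu L M A))"

definition pos_loeb_measure :: "'a elem measure" where
  "pos_loeb_measure = (THE N. is_pos_loeb_measure N)"

definition is_signed_loeb_measure :: "('a elem set \<Rightarrow> real) \<Rightarrow> bool" where
  "is_signed_loeb_measure \<nu> \<longleftrightarrow>
     is_signed_measure (Om L M) loeb_algebra \<nu> \<and>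
     total_variation (Om L M) loeb_algebra \<nu> = ennreal (signed_norm L M) \<and>
     (\<forall>A\<in>Alg L M. \<nu> (loeb_set A) = mu L M A)"

definition signed_loeb_measure :: "'a elem set \<Rightarrow> real" where
  "signed_loeb_measure = (THE \<nu>. is_signed_loeb_measure \<nu>)"

end

end

theory Submission
  imports Defs
begin

text \<open>
  By saturation, countably many internal sets with the finite intersection property have a common
  point. Hence every nonnegative finitely additive function on the internal algebra is continuous at
  the empty set and extends to the generated \<open>\<sigma>\<close>-algebra by Caratheodory's theorem. A bounded charge is
  the difference of its upper variation and another nonnegative charge, and the extensions of these
  two give the signed Loeb measure with the right total variation.

  Approximate measurability of \<open>f\<close> makes it Loeb measurable, and also provides, for every \<open>e > 0\<close>, an
  element \<open>g\<close> in the span of the internal characteristic functions with \<open>\<bar>f - g\<bar> \<le> e\<close>. On such \<open>g\<close> the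
  functional \<open>I\<close> agrees with the integral, and both are Lipschitz in the supremum norm.
\<close>

section \<open>Bounded charges on an algebra of sets\<close>

locale bounded_charge = algebra \<Omega> \<A> for \<Omega> :: "'a set" and \<A> +
  fixes m :: "'a set \<Rightarrow> real" and C :: real
  assumes add: "A \<in> \<A> \<Longrightarrow> B \<in> \<A> \<Longrightarrow> A \<inter> B = {} \<Longrightarrow> m (A \<union> B) = m A + m B"
    and bounded: "A \<in> \<A> \<Longrightarrow> \<bar>m A\<bar> \<le> C"
begin

lemma charge_empty: "m {} = 0"
  using add[of "{}" "{}"] by simp

text \<open>The positive part in the Jordan decomposition of a charge, taken over members of the
  algebra only. The empty set always competes in the supremum, so it is over a nonempty family and
  is nonnegative.\<close>

definition upper_variation :: "'a set \<Rightarrow> real" where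
  "upper_variation A = (SUP B\<in>{B\<in>\<A>. B \<subseteq> A}. m B)"

lemma upper_variation_bdd: "bdd_above (m ` {B\<in>\<A>. B \<subseteq> A})"
  using bounded by (intro bdd_aboveI2[where M = C]) (auto dest: bounded simp: abs_le_iff)

lemma upper_variation_upper: "B \<in> \<A> \<Longrightarrow> B \<subseteq> A \<Longrightarrow> m B \<le> upper_variation A"
  unfolding upper_variation_def by (intro cSUP_upper upper_variation_bdd) auto

lemma upper_variation_least:
  "(\<And>B. B \<in> \<A> \<Longrightarrow> B \<subseteq> A \<Longrightarrow> m B \<le> x) \<Longrightarrow> upper_variation A \<le> x"
  unfolding upper_variation_def by (intro cSUP_least) auto

lemma upper_variation_nonneg: "0 \<le> upper_variation A"
  using upper_variation_upper[of "{}" A] charge_empty by simp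

text \<open>A competitor inside \<open>A \<union> B\<close> splits into competitors inside
  \<open>A\<close> and \<open>B\<close>, and disjoint competitors can be glued together.\<close>

lemma upper_variation_add:
  assumes "A \<in> \<A>" "B \<in> \<A>" "A \<inter> B = {}"
  shows "upper_variation (A \<union> B) = upper_variation A + upper_variation B"
proof (rule antisym)
  show "upper_variation (A \<union> B) \<le> upper_variation A + upper_variation B"
  proof (rule upper_variation_least)
    fix E assume E: "E \<in> \<A>" "E \<subseteq> A \<union> B"
    have "m E = m ((E \<inter> A) \<union> (E \<inter> B))"
      using E by (intro arg_cong[of _ _ m]) auto
    also have "\<dots> = m (E \<inter> A) + m (E \<inter> B)"
      using E assms by (intro add) auto
    also have "\<dots> \<le> upper_variation A + upper_variation B"
      using E assms by (intro add_mono upper_variation_upper) auto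
    finally show "m E \<le> upper_variation A + upper_variation B" .
  qed
  \<comment> \<open>The two suprema are taken one after the other: first over \<open>F\<close> with
    \<open>E\<close> fixed, then over \<open>E\<close>.\<close>
  have "upper_variation A \<le> upper_variation (A \<union> B) - upper_variation B"
  proof (rule upper_variation_least)
    fix E assume E: "E \<in> \<A>" "E \<subseteq> A"
    have "upper_variation B \<le> upper_variation (A \<union> B) - m E"
    proof (rule upper_variation_least)
      fix F assume F: "F \<in> \<A>" "F \<subseteq> B"
      have "m E + m F = m (E \<union> F)"
        using E F assms by (intro add[symmetric]) auto
      also have "\<dots> \<le> upper_variation (A \<union> B)"
        using E F by (intro upper_variation_upper) auto
      finally show "m F \<le> upper_variation (A \<union> B) - m E" by simp
    qed
    then show "m E \<le> upper_variation (A \<union> B) - upper_variation B" by simp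
  qed
  then show "upper_variation A + upper_variation B \<le> upper_variation (A \<union> B)" by simp
qed

end

text \<open>Compactness makes a decreasing sequence with empty intersection reach the empty set
  after finitely many steps. Continuity at the empty set is then trivial, since the values are
  eventually 0, and Caratheodory's theorem applies.\<close>

lemma (in algebra) additive_extends_to_measure:
  assumes compact: "\<And>E :: nat \<Rightarrow> 'a set. range E \<subseteq> M \<Longrightarrow> decseq E \<Longrightarrow> (\<Inter>n. E n) = {} \<Longrightarrow> \<exists>n. E n = {}"
    and nonneg: "\<And>A. A \<in> M \<Longrightarrow> 0 \<le> p A"
    and add: "\<And>A B. A \<in> M \<Longrightarrow> B \<in> M \<Longrightarrow> A \<inter> B = {} \<Longrightarrow> p (A \<union> B) = p A + (p B :: real)"
  obtains P where "finite_measure P" "space P = \<Omega>" "sets P = sigma_sets \<Omega> M"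
    "\<And>A. A \<in> M \<Longrightarrow> emeasure P A = ennreal (p A)"
proof -
  have p0: "p {} = 0" using add[of "{}" "{}"] by simp
  have "\<exists>\<mu>. (\<forall>s\<in>M. \<mu> s = ennreal (p s)) \<and> measure_space \<Omega> (sigma_sets \<Omega> M) \<mu>"
  proof (rule caratheodory_empty_continuous)
    show "positive M (\<lambda>A. ennreal (p A))"
      by (simp add: positive_def p0)
    show "additive M (\<lambda>A. ennreal (p A))"
      by (simp add: additive_def add nonneg flip: ennreal_plus)
    fix E :: "nat \<Rightarrow> 'a set"
    assume E: "range E \<subseteq> M" "decseq E" "(\<Inter>n. E n) = {}"
    from compact[OF this] obtain n where n: "E n = {}" by blast
    have "ennreal (p (E k)) = 0" if "k \<ge> n" for k
      using decseqD[OF E(2) that] n p0 by simp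
    then show "(\<lambda>n. ennreal (p (E n))) \<longlonglongrightarrow> 0"
      by (intro tendsto_eventually eventually_sequentiallyI)
  qed simp
  then obtain \<mu> where \<mu>: "\<And>s. s \<in> M \<Longrightarrow> \<mu> s = ennreal (p s)"
    and ms: "measure_space \<Omega> (sigma_sets \<Omega> M) \<mu>" by blast
  define P where "P = measure_of \<Omega> (sigma_sets \<Omega> M) \<mu>"
  have sub: "sigma_sets \<Omega> M \<subseteq> Pow \<Omega>"
    using sigma_sets_into_sp[OF space_closed] by blast
  have sets: "sets P = sigma_sets \<Omega> M" and space: "space P = \<Omega>"
    using sub by (simp_all add: P_def sigma_sets_sigma_sets_eq space_closed)
  have em: "emeasure P A = ennreal (p A)" if "A \<in> M" for A
  proof -
    have "emeasure P A = \<mu> A"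
      using ms sub that sets unfolding P_def measure_space_def
      by (intro emeasure_measure_of[OF refl]) (auto simp: sigma_sets_sigma_sets_eq space_closed)
    then show ?thesis using \<mu>[OF that] by simp
  qed
  have "finite_measure P"
    using em[OF top] by (intro finite_measureI) (simp add: space)
  with sets space em show thesis by (intro that)
qed

text \<open>\<open>P\<close> extends the upper variation \<open>u\<close> and \<open>N\<close>
  extends \<open>u - m\<close>, which is nonnegative because every set competes in its own supremum.
  The last clause is the minimality of this decomposition; it later bounds the total mass by the
  total variation.\<close>

lemma (in bounded_charge) jordan_extension:
  assumes compact: "\<And>E :: nat \<Rightarrow> 'a set. range E \<subseteq> \<A> \<Longrightarrow> decseq E \<Longrightarrow> (\<Inter>n. E n) = {} \<Longrightarrow> \<exists>n. E n = {}"
  obtains P N where "finite_measure P" "finite_measure N"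
    "space P = \<Omega>" "space N = \<Omega>"
    "sets P = sigma_sets \<Omega> \<A>" "sets N = sigma_sets \<Omega> \<A>"
    "\<And>A. A \<in> \<A> \<Longrightarrow> m A = measure P A - measure N A"
    "\<And>x. (\<And>A. A \<in> \<A> \<Longrightarrow> m A - m (\<Omega> - A) \<le> x) \<Longrightarrow> measure P \<Omega> + measure N \<Omega> \<le> x"
proof -
  obtain P where P: "finite_measure P" "space P = \<Omega>" "sets P = sigma_sets \<Omega> \<A>"
    "\<And>A. A \<in> \<A> \<Longrightarrow> emeasure P A = ennreal (upper_variation A)"
    by (rule additive_extends_to_measure[of upper_variation])
       (use compact upper_variation_nonneg upper_variation_add in auto)
  have nn: "0 \<le> upper_variation A - m A" if "A \<in> \<A>" for A
    using upper_variation_upper[OF that order_refl] by simp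
  obtain N where N: "finite_measure N" "space N = \<Omega>" "sets N = sigma_sets \<Omega> \<A>"
    "\<And>A. A \<in> \<A> \<Longrightarrow> emeasure N A = ennreal (upper_variation A - m A)"
  proof (rule additive_extends_to_measure[of "\<lambda>A. upper_variation A - m A"])
    show "upper_variation (A \<union> B) - m (A \<union> B) = upper_variation A - m A + (upper_variation B - m B)"
      if "A \<in> \<A>" "B \<in> \<A>" "A \<inter> B = {}" for A B
      using that by (simp add: add upper_variation_add)
  qed (use compact nn in auto)
  have meas: "measure P A = upper_variation A" "measure N A = upper_variation A - m A" if "A \<in> \<A>" for A
    using P(4)[OF that] N(4)[OF that] nn[OF that] upper_variation_nonneg[of A] by (simp_all add: measure_def)
  show thesis
  proof (rule that[OF P(1) N(1) P(2) N(2) P(3) N(3)])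
    show "m A = measure P A - measure N A" if "A \<in> \<A>" for A
      using meas[OF that] by simp
    fix x assume x: "\<And>A. A \<in> \<A> \<Longrightarrow> m A - m (\<Omega> - A) \<le> x"
    \<comment> \<open>The total mass is twice the upper variation of the whole space minus
      \<open>m \<Omega>\<close>. As \<open>m (\<Omega> - A) = m \<Omega> - m A\<close>, the
      hypothesis on \<open>x\<close> reads \<open>m A \<le> (x + m \<Omega>) / 2\<close>.\<close>
    have "upper_variation \<Omega> \<le> (x + m \<Omega>) / 2"
    proof (rule upper_variation_least)
      fix A assume A: "A \<in> \<A>" "A \<subseteq> \<Omega>"
      have "m \<Omega> = m (A \<union> (\<Omega> - A))" using A by (simp add: Un_absorb1)
      also have "\<dots> = m A + m (\<Omega> - A)" using A by (intro add) auto
      finally show "m A \<le> (x + m \<Omega>) / 2" using x[OF A(1)] by simp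
    qed
    then show "measure P \<Omega> + measure N \<Omega> \<le> x" using meas[OF top] by simp
  qed
qed

section \<open>Differences of finite measures\<close>

lemma is_signed_measure_diff:
  assumes "finite_measure P" "finite_measure N" "space P = X" "sets P = \<Sigma>" "sets N = \<Sigma>"
  shows "is_signed_measure X \<Sigma> (\<lambda>E. measure P E - measure N E)"
proof -
  interpret P: finite_measure P by fact
  interpret N: finite_measure N by fact
  have "sigma_algebra X \<Sigma>" using sets.sigma_algebra_axioms[of P] assms by simp
  moreover have "(\<lambda>n. measure P (E n) - measure N (E n)) sums (measure P (\<Union>n. E n) - measure N (\<Union>n. E n))"
    if "range E \<subseteq> \<Sigma>" "disjoint_family E" for E :: "nat \<Rightarrow> _"
    using that assms by (intro sums_diff P.finite_measure_UNION N.finite_measure_UNION) auto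
  \<comment> \<open>\<open>measure\<close> is 0 on nonmeasurable sets, which is the normalization
    demanded of a signed measure.\<close>
  ultimately show ?thesis using assms by (auto simp: is_signed_measure_def measure_notin_sets)
qed

text \<open>Dynkin's pi-lambda argument: the sets on which both measures agree are closed under
  complements, because the values at \<open>X\<close> agree, and under countable disjoint
  unions.\<close>

lemma signed_measure_eqI:
  assumes \<mu>: "is_signed_measure X \<Sigma> \<mu>" and \<nu>: "is_signed_measure X \<Sigma> \<nu>"
    and gen: "\<Sigma> = sigma_sets X G" "Int_stable G" "G \<subseteq> Pow X" "X \<in> G"
    and eq: "\<And>A. A \<in> G \<Longrightarrow> \<mu> A = \<nu> A"
  shows "\<mu> = \<nu>"
proof
  fix E
  interpret sigma_algebra X \<Sigma> using \<mu> by (simp add: is_signed_measure_def)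
  \<comment> \<open>Signed measures are only given as countably additive, so finite additivity is
    obtained by padding the two sets with empty ones.\<close>
  have diff_space: "\<rho> (X - A) = \<rho> X - \<rho> A" if \<rho>: "is_signed_measure X \<Sigma> \<rho>" and A: "A \<in> \<Sigma>" for \<rho> A
  proof -
    have b: "range (binaryset A (X - A)) \<subseteq> \<Sigma>" "disjoint_family (binaryset A (X - A))"
      using A by (auto simp: range_binaryset_eq disjoint_family_on_def binaryset_def)
    have "(\<lambda>n. \<rho> (binaryset A (X - A) n)) sums \<rho> (\<Union>n. binaryset A (X - A) n)"
      using \<rho> b unfolding is_signed_measure_def by blast
    moreover have "(\<lambda>n. \<rho> (binaryset A (X - A) n)) sums (\<rho> A + \<rho> (X - A))"
      using \<rho> by (intro binaryset_sums) (simp add: is_signed_measure_def)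
    ultimately have "\<rho> (\<Union>n. binaryset A (X - A) n) = \<rho> A + \<rho> (X - A)"
      by (rule sums_unique2)
    moreover have "(\<Union>n. binaryset A (X - A) n) = X"
      using A sets_into_space by (auto simp: UN_binaryset_eq)
    ultimately show ?thesis by simp
  qed
  show "\<mu> E = \<nu> E"
  proof (cases "E \<in> \<Sigma>")
    case True
    then have "E \<in> sigma_sets X G" using gen by simp
    from gen(2,3) this show ?thesis
    proof (induction rule: sigma_sets_induct_disjoint)
      case (basic A)
      then show ?case by (rule eq)
    next
      case empty
      then show ?case using \<mu> \<nu> by (simp add: is_signed_measure_def)
    next
      case (compl A)
      then show ?case
        using diff_space[OF \<mu>] diff_space[OF \<nu>] gen eq by simp
    next
      case (union A)
      then have "(\<lambda>n. \<mu> (A n)) sums \<mu> (\<Union>n. A n)" "(\<lambda>n. \<nu> (A n)) sums \<nu> (\<Union>n. A n)"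
        using \<mu> \<nu> gen unfolding is_signed_measure_def by blast+
      with union show ?case by (simp add: sums_unique2)
    qed
  qed (use \<mu> \<nu> in \<open>simp add: is_signed_measure_def\<close>)
qed

text \<open>On every partition, \<open>\<bar>\<nu> E\<bar>\<close> is at most the sum of the two
  measures of \<open>E\<close>. Conversely, the two-piece partitions by members of \<open>G\<close>
  already exhaust the mass; \<open>least\<close> has the form of the minimality clause of
  \<open>jordan_extension\<close>.\<close>

lemma total_variation_diff:
  assumes P: "finite_measure P" "space P = X" "sets P = \<Sigma>"
    and N: "finite_measure N" "sets N = \<Sigma>"
    and G: "G \<subseteq> \<Sigma>" and X: "X \<noteq> {}"
    and least: "\<And>x. (\<And>A. A \<in> G \<Longrightarrow> \<nu> A - \<nu> (X - A) \<le> x) \<Longrightarrow> measure P X + measure N X \<le> x"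
    and \<nu>: "\<And>E. E \<in> \<Sigma> \<Longrightarrow> \<nu> E = measure P E - measure N E"
  shows "total_variation X \<Sigma> \<nu> = ennreal (measure P X + measure N X)"
proof -
  interpret P: finite_measure P by fact
  interpret N: finite_measure N by fact
  define V where "V = measure P X + measure N X"
  define parts where "parts = {D. finite D \<and> D \<subseteq> \<Sigma> \<and> disjoint D \<and> \<Union>D = X}"
  have tv: "total_variation X \<Sigma> \<nu> = (SUP D\<in>parts. \<Sum>E\<in>D. ennreal \<bar>\<nu> E\<bar>)"
    by (simp add: total_variation_def parts_def)
  have "total_variation X \<Sigma> \<nu> \<le> ennreal V"
    unfolding tv
  proof (rule SUP_least)
    fix D assume "D \<in> parts"
    then have D: "finite D" "D \<subseteq> \<Sigma>" "disjoint D" "\<Union>D = X" by (auto simp: parts_def)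
    have dis: "disjoint_family_on (\<lambda>E. E) D"
      using D(3) by (auto simp: disjoint_family_on_def disjoint_def)
    have "(\<Sum>E\<in>D. ennreal \<bar>\<nu> E\<bar>) = ennreal (\<Sum>E\<in>D. \<bar>\<nu> E\<bar>)"
      by (simp add: sum_ennreal)
    also have "\<dots> \<le> ennreal (\<Sum>E\<in>D. measure P E + measure N E)"
    proof (intro ennreal_leI sum_mono)
      fix E assume "E \<in> D"
      then have "\<nu> E = measure P E - measure N E" using \<nu> D(2) by auto
      then show "\<bar>\<nu> E\<bar> \<le> measure P E + measure N E"
        using measure_nonneg[of P E] measure_nonneg[of N E] by linarith
    qed
    also have "(\<Sum>E\<in>D. measure P E + measure N E) = V"
      unfolding sum.distrib V_def
      using P.finite_measure_finite_Union[OF D(1) _ dis] N.finite_measure_finite_Union[OF D(1) _ dis]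
        D P N by simp
    finally show "(\<Sum>E\<in>D. ennreal \<bar>\<nu> E\<bar>) \<le> ennreal V" .
  qed
  moreover have "ennreal V \<le> total_variation X \<Sigma> \<nu>"
  \<comment> \<open>An infinite variation bounds everything; a finite one is a real number to which
    \<open>least\<close> can be applied.\<close>
  proof (cases "total_variation X \<Sigma> \<nu>" rule: ennreal_cases)
    case (real t)
    have "V \<le> t"
      unfolding V_def
    proof (rule least)
      fix A assume "A \<in> G"
      then have A: "A \<in> sets P" "A \<subseteq> X" using G P sets.sets_into_space[of A P] by auto
      have c: "X - A \<in> sets P" using A P by (metis sets.compl_sets)
      have "{A, X - A} \<in> parts"
        using A c P by (auto simp: parts_def disjoint_def)
      then have "(\<Sum>E\<in>{A, X - A}. ennreal \<bar>\<nu> E\<bar>) \<le> ennreal t"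
        unfolding real(2)[symmetric] tv by (rule SUP_upper)
      \<comment> \<open>A partition is a set of sets, so the two summands are both counted only if
        the pieces differ. They do because \<open>X\<close> is nonempty.\<close>
      moreover have "A \<noteq> X - A" using A X by auto
      ultimately have "ennreal (\<bar>\<nu> A\<bar> + \<bar>\<nu> (X - A)\<bar>) \<le> ennreal t"
        by (simp add: ennreal_plus)
      then have "\<bar>\<nu> A\<bar> + \<bar>\<nu> (X - A)\<bar> \<le> t" using ennreal_le_iff[OF real(1)] by blast
      then show "\<nu> A - \<nu> (X - A) \<le> t" by linarith
    qed
    then show ?thesis using real by (simp add: ennreal_leI)
  qed simp
  ultimately show ?thesis by (simp add: V_def)
qed

text \<open>\<open>Y\<close> is the positive half of a Hahn decomposition, and the supremum defining
  the positive part at \<open>E\<close> is attained at \<open>E \<inter> Y\<close>. Keeping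
  \<open>Y\<close> as a parameter allows a second application with \<open>P\<close> and
  \<open>N\<close> exchanged and \<open>Y\<close> replaced by its complement.\<close>

lemma jordan_pos_diff:
  assumes P: "finite_measure P" "space P = X" "sets P = \<Sigma>"
    and N: "finite_measure N" "sets N = \<Sigma>"
    and Y: "Y \<in> \<Sigma>" "\<And>E. E \<in> \<Sigma> \<Longrightarrow> E \<subseteq> Y \<Longrightarrow> measure N E \<le> measure P E"
      "\<And>E. E \<in> \<Sigma> \<Longrightarrow> E \<inter> Y = {} \<Longrightarrow> measure P E \<le> measure N E"
    and \<nu>: "\<And>E. E \<in> \<Sigma> \<Longrightarrow> \<nu> E = measure P E - measure N E"
  shows "finite_measure (jordan_pos X \<Sigma> \<nu>)" "space (jordan_pos X \<Sigma> \<nu>) = X" "sets (jordan_pos X \<Sigma> \<nu>) = \<Sigma>"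
    "\<And>E. E \<in> \<Sigma> \<Longrightarrow> measure (jordan_pos X \<Sigma> \<nu>) E = measure P (E \<inter> Y) - measure N (E \<inter> Y)"
proof -
  interpret P: finite_measure P by fact
  interpret N: finite_measure N by fact
  have sa: "sigma_algebra X \<Sigma>" using sets.sigma_algebra_axioms[of P] P by simp
  interpret sigma_algebra X \<Sigma> by fact
  define f where "f E = (SUP F\<in>{F\<in>\<Sigma>. F \<subseteq> E}. ennreal (\<nu> F))" for E
  \<comment> \<open>For a competitor \<open>F\<close>, dropping \<open>F - Y\<close> and adding
    \<open>(E - F) \<inter> Y\<close> both do not decrease \<open>\<nu>\<close>.\<close>
  have f: "f E = ennreal (\<nu> (E \<inter> Y))" if E: "E \<in> \<Sigma>" for E
    unfolding f_def
  proof (rule antisym[OF SUP_least SUP_upper])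
    fix F assume "F \<in> {F \<in> \<Sigma>. F \<subseteq> E}"
    then have F: "F \<in> \<Sigma>" "F \<subseteq> E" by auto
    have less_outside: "measure P (F - Y) \<le> measure N (F - Y)"
      using F Y by (intro Y) auto
    have more_inside: "measure N ((E - F) \<inter> Y) \<le> measure P ((E - F) \<inter> Y)"
      using E F Y by (intro Y) auto
    have "measure Q F = measure Q (F \<inter> Y) + measure Q (F - Y)"
      "measure Q (E \<inter> Y) = measure Q (F \<inter> Y) + measure Q ((E - F) \<inter> Y)"
      if "finite_measure Q" "sets Q = \<Sigma>" for Q
    proof -
      interpret Q: finite_measure Q by fact
      have "measure Q F = measure Q ((F \<inter> Y) \<union> (F - Y))"
        by (intro arg_cong[of _ _ "measure Q"]) auto
      also have "\<dots> = measure Q (F \<inter> Y) + measure Q (F - Y)"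
        using F Y that by (intro Q.finite_measure_Union) auto
      finally show "measure Q F = measure Q (F \<inter> Y) + measure Q (F - Y)" .
      have "measure Q (E \<inter> Y) = measure Q ((F \<inter> Y) \<union> ((E - F) \<inter> Y))"
        using F by (intro arg_cong[of _ _ "measure Q"]) auto
      also have "\<dots> = measure Q (F \<inter> Y) + measure Q ((E - F) \<inter> Y)"
        using E F Y that by (intro Q.finite_measure_Union) auto
      finally show "measure Q (E \<inter> Y) = measure Q (F \<inter> Y) + measure Q ((E - F) \<inter> Y)" .
    qed
    note split = this
    have "\<nu> F \<le> \<nu> (E \<inter> Y)"
      using split(1)[OF P(1,3)] split(1)[OF N] split(2)[OF P(1,3)] split(2)[OF N]
        less_outside more_inside \<nu>[OF F(1)] \<nu>[OF Int[OF E Y(1)]] by linarith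
    then show "ennreal (\<nu> F) \<le> ennreal (\<nu> (E \<inter> Y))" by (rule ennreal_leI)
  qed (use E Y in auto)
  have sums: "(\<lambda>n. \<nu> (E n \<inter> Y)) sums \<nu> ((\<Union>n. E n) \<inter> Y)" if "range E \<subseteq> \<Sigma>" "disjoint_family E"
    for E :: "nat \<Rightarrow> _"
  proof -
    have "range (\<lambda>n. E n \<inter> Y) \<subseteq> \<Sigma>" "disjoint_family (\<lambda>n. E n \<inter> Y)"
      using that Y by (auto simp: disjoint_family_on_def)
    then have "(\<lambda>n. measure P (E n \<inter> Y) - measure N (E n \<inter> Y)) sums
        (measure P (\<Union>n. E n \<inter> Y) - measure N (\<Union>n. E n \<inter> Y))"
      using P N by (intro sums_diff P.finite_measure_UNION N.finite_measure_UNION) auto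
    moreover have "(\<Union>n. E n \<inter> Y) \<in> \<Sigma>" "\<And>n. E n \<inter> Y \<in> \<Sigma>"
      using that Y by auto
    ultimately show ?thesis by (simp add: \<nu>)
  qed
  have nn: "0 \<le> \<nu> (E \<inter> Y)" if "E \<in> \<Sigma>" for E
    using Y(2)[OF Int[OF that Y(1)]] \<nu>[OF Int[OF that Y(1)]] by simp
  \<comment> \<open>\<open>measure_of\<close> returns the given set function only when that function
    is a measure, so this precedes any computation with \<open>jordan_pos\<close>.\<close>
  have "measure_space X \<Sigma> f"
    unfolding measure_space_def
  proof (intro conjI sa)
    show "positive \<Sigma> f" by (simp add: positive_def f \<nu>)
    show "countably_additive \<Sigma> f"
    proof (rule countably_additiveI)
      fix E :: "nat \<Rightarrow> _" assume E: "range E \<subseteq> \<Sigma>" "disjoint_family E" "(\<Union>n. E n) \<in> \<Sigma>"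
      have "(\<Sum>n. f (E n)) = (\<Sum>n. ennreal (\<nu> (E n \<inter> Y)))" using E by (intro suminf_cong f) auto
      also have "\<dots> = ennreal (\<nu> ((\<Union>n. E n) \<inter> Y))"
        using E nn by (intro suminf_ennreal_eq sums) auto
      finally show "(\<Sum>n. f (E n)) = f (\<Union>n. E n)" using E f by simp
    qed
  qed
  moreover have J: "jordan_pos X \<Sigma> \<nu> = measure_of X \<Sigma> f"
    by (simp add: jordan_pos_def f_def[abs_def])
  ultimately have em: "emeasure (jordan_pos X \<Sigma> \<nu>) E = f E" if "E \<in> \<Sigma>" for E
    using that by (simp add: emeasure_measure_of_sigma measure_space_def)
  show sp: "space (jordan_pos X \<Sigma> \<nu>) = X" and st: "sets (jordan_pos X \<Sigma> \<nu>) = \<Sigma>"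
    unfolding J using space_closed sigma_sets_eq by simp_all
  show "finite_measure (jordan_pos X \<Sigma> \<nu>)"
    using em[OF top] f[OF top] by (intro finite_measureI) (simp add: sp)
  show "measure (jordan_pos X \<Sigma> \<nu>) E = measure P (E \<inter> Y) - measure N (E \<inter> Y)" if "E \<in> \<Sigma>" for E
    using em[OF that] f[OF that] nn[OF that] \<nu>[OF Int[OF that Y(1)]] by (simp add: measure_def)
qed

text \<open>\<open>P\<close> and \<open>N\<close> need not be mutually singular. The Jordan parts
  are \<open>P - N\<close> restricted to a Hahn set \<open>Y\<close> and \<open>N - P\<close>
  restricted to its complement, and adding over the two halves of \<open>E\<close> recovers
  \<open>\<nu> E\<close>.\<close>

lemma jordan_decomposition_diff:
  assumes P: "finite_measure P" "space P = X" "sets P = \<Sigma>"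
    and N: "finite_measure N" "sets N = \<Sigma>"
    and \<nu>: "\<And>E. E \<in> \<Sigma> \<Longrightarrow> \<nu> E = measure P E - measure N E"
  shows "finite_measure (jordan_pos X \<Sigma> \<nu>)" "space (jordan_pos X \<Sigma> \<nu>) = X" "sets (jordan_pos X \<Sigma> \<nu>) = \<Sigma>"
    "finite_measure (jordan_neg X \<Sigma> \<nu>)" "space (jordan_neg X \<Sigma> \<nu>) = X" "sets (jordan_neg X \<Sigma> \<nu>) = \<Sigma>"
    "\<And>E. E \<in> \<Sigma> \<Longrightarrow> \<nu> E = measure (jordan_pos X \<Sigma> \<nu>) E - measure (jordan_neg X \<Sigma> \<nu>) E"
proof -
  interpret P: finite_measure P by fact
  interpret N: finite_measure N by fact
  obtain Y where Y: "Y \<in> sets P" "\<forall>E\<in>sets P. E \<subseteq> Y \<longrightarrow> N E \<le> P E"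
    "\<forall>E\<in>sets P. E \<inter> Y = {} \<longrightarrow> P E \<le> N E"
    using finite_unsigned_Hahn_decomposition[of P N] P N by auto
  have Y1: "Y \<in> \<Sigma>" using Y P by simp
  have Y2: "measure N E \<le> measure P E" if "E \<in> \<Sigma>" "E \<subseteq> Y" for E
    using Y(2) that P by (simp add: P.emeasure_eq_measure N.emeasure_eq_measure)
  have Y3: "measure P E \<le> measure N E" if "E \<in> \<Sigma>" "E \<inter> Y = {}" for E
    using Y(3) that P by (simp add: P.emeasure_eq_measure N.emeasure_eq_measure)
  have X: "\<And>E. E \<in> \<Sigma> \<Longrightarrow> E \<subseteq> X" using P sets.sets_into_space by metis
  have Yc: "X - Y \<in> \<Sigma>" using Y1 P by (metis sets.compl_sets)
  have N': "space N = X" using P N by (metis sets_eq_imp_space_eq)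
  note pos = jordan_pos_diff[OF P N Y1 Y2 Y3 \<nu>]
  have Yc1: "measure P E \<le> measure N E" if "E \<in> \<Sigma>" "E \<subseteq> X - Y" for E
    using that by (intro Y3) auto
  have Yc2: "measure N E \<le> measure P E" if "E \<in> \<Sigma>" "E \<inter> (X - Y) = {}" for E
    using that X by (intro Y2) auto
  have \<nu>': "- \<nu> E = measure N E - measure P E" if "E \<in> \<Sigma>" for E
    using \<nu>[OF that] by simp
  \<comment> \<open>The negative part is the positive part of \<open>N - P\<close>, whose Hahn set
    is the complement of \<open>Y\<close>.\<close>
  note neg = jordan_pos_diff[OF N(1) N' N(2) P(1,3) Yc Yc1 Yc2 \<nu>', folded jordan_neg_def]
  show "finite_measure (jordan_pos X \<Sigma> \<nu>)" "space (jordan_pos X \<Sigma> \<nu>) = X" "sets (jordan_pos X \<Sigma> \<nu>) = \<Sigma>"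
    by (rule pos; assumption)+
  show "finite_measure (jordan_neg X \<Sigma> \<nu>)" "space (jordan_neg X \<Sigma> \<nu>) = X" "sets (jordan_neg X \<Sigma> \<nu>) = \<Sigma>"
    by (rule neg; assumption)+
  fix E assume E: "E \<in> \<Sigma>"
  have pos4: "measure (jordan_pos X \<Sigma> \<nu>) E = measure P (E \<inter> Y) - measure N (E \<inter> Y)"
    by (rule pos(4); (assumption | fact))
  have neg4: "measure (jordan_neg X \<Sigma> \<nu>) E = measure N (E \<inter> (X - Y)) - measure P (E \<inter> (X - Y))"
    by (rule neg(4); (assumption | fact))
  have "measure Q E = measure Q (E \<inter> Y) + measure Q (E \<inter> (X - Y))"
    if "finite_measure Q" "sets Q = \<Sigma>" for Q
  proof -
    interpret Q: finite_measure Q by fact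
    have "measure Q E = measure Q ((E \<inter> Y) \<union> (E \<inter> (X - Y)))"
      using X[OF E] by (intro arg_cong[of _ _ "measure Q"]) auto
    also have "\<dots> = measure Q (E \<inter> Y) + measure Q (E \<inter> (X - Y))"
      using E Y1 Yc that by (intro Q.finite_measure_Union) auto
    finally show ?thesis .
  qed
  from this[OF P(1,3)] this[OF N(1,2)]
  show "\<nu> E = measure (jordan_pos X \<Sigma> \<nu>) E - measure (jordan_neg X \<Sigma> \<nu>) E"
    using neg4 pos4 \<nu>[OF E] by simp
qed

section \<open>Countable compactness of the internal sets\<close>

text \<open>Relaxing bounds weakens atomic formulas, enlarges the ball of an existential quantifier
  and shrinks that of a universal one. Approximate satisfaction may therefore be proved by exact
  satisfaction.\<close>

lemma sat_approximation: "approximation \<phi> \<phi>' \<Longrightarrow> sat M e \<phi> \<Longrightarrow> sat M e \<phi>'"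
proof (induction arbitrary: e rule: approximation.induct)
  case (1 q q' t)
  then have "(of_rat q :: real) < of_rat q'" by (simp add: of_rat_less)
  with 1 show ?case by simp
next
  case (2 q' q t)
  then have "(of_rat q' :: real) < of_rat q" by (simp add: of_rat_less)
  with 2 show ?case by simp
next
  case (5 q q' \<phi> \<phi>' v)
  then have "(of_rat q :: real) < of_rat q'" by (simp add: of_rat_less)
  with 5 show ?case by fastforce
next
  case (6 q' q \<phi> \<phi>' v)
  then have "(of_rat q' :: real) < of_rat q" by (simp add: of_rat_less)
  with 6 show ?case by fastforce
qed auto

lemma sat_conj_list: "\<phi>s \<noteq> [] \<Longrightarrow> sat M e (conj_list \<phi>s) \<longleftrightarrow> (\<forall>\<phi>\<in>set \<phi>s. sat M e \<phi>)"
  by (induction \<phi>s rule: conj_list.induct) auto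

lemma interp_in_univ:
  assumes "is_metric_structure L M" "has_type L f ss s" "list_all2 (\<lambda>x s. x \<in> univ M s) xs ss"
  shows "interp M f xs \<in> univ M s"
  using assms by (auto simp: is_metric_structure_def has_type_def prod_univ_def)

text \<open>The summand \<open>natLeq\<close> in \<open>card_sig\<close> puts every countable set of
  parameters within reach of saturation.\<close>

lemma countable_less_cardSuc_card_sig:
  assumes "countable P"
  shows "|P| <o cardSuc (card_sig L)"
proof -
  have "|P| \<le>o natLeq"
    using assms card_of_nat by (auto simp: countable_def intro: card_of_ordLeqI ordLeq_ordIso_trans)
  also have "natLeq \<le>o card_sig L"
    unfolding card_sig_def by (intro ordLeq_csum2 natLeq_Card_order)
  finally show ?thesis
    by (rule ordLeq_ordLess_trans) (simp add: card_sig_def cardSuc_greater Card_order_csum)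
qed

section \<open>The internal sets as an algebra of subsets of \<open>Om\<close>\<close>

locale pre_loeb =
  fixes L :: "('s,'f,'z) loeb_signature_scheme" and M :: "('s,'f,'a) metric_structure"
  assumes loeb_signature: "is_loeb_signature L" and base: "pre_loeb_base L M"
begin

lemma metric_structure: "is_metric_structure L M"
  using base by (simp add: pre_loeb_base_def)

lemma anchor_Om: "anchor M (Omega_sort L) \<in> Om L M"
  using metric_structure loeb_signature
  by (auto simp: is_metric_structure_def is_loeb_signature_def Om_def)

lemma alg_closed:
  "empty_alg L M \<in> Alg L M" "full_alg L M \<in> Alg L M"
  "A \<in> Alg L M \<Longrightarrow> compl L M A \<in> Alg L M"
  "A \<in> Alg L M \<Longrightarrow> B \<in> Alg L M \<Longrightarrow> cup L M A B \<in> Alg L M"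
  "A \<in> Alg L M \<Longrightarrow> B \<in> Alg L M \<Longrightarrow> cap L M A B \<in> Alg L M"
  unfolding empty_alg_def full_alg_def compl_def cup_def cap_def Alg_def
  by (rule interp_in_univ[OF metric_structure];
      use loeb_signature in \<open>force simp: is_loeb_signature_def has_type_def\<close>)+

lemma mem_cases: "\<omega> \<in> Om L M \<Longrightarrow> A \<in> Alg L M \<Longrightarrow> mem L M \<omega> A = 0 \<or> mem L M \<omega> A = 1"
  using base by (auto simp: pre_loeb_base_def)

lemma mem_eq_indicator:
  assumes "\<omega> \<in> Om L M" "A \<in> Alg L M"
  shows "mem L M \<omega> A = indicator (loeb_set L M A) \<omega>"
  using mem_cases[OF assms] assms by (auto simp: loeb_set_def indicator_def)

lemma loeb_set_simps:
  "loeb_set L M (empty_alg L M) = {}"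
  "loeb_set L M (full_alg L M) = Om L M"
  "A \<in> Alg L M \<Longrightarrow> loeb_set L M (compl L M A) = Om L M - loeb_set L M A"
  "A \<in> Alg L M \<Longrightarrow> B \<in> Alg L M \<Longrightarrow> loeb_set L M (cup L M A B) = loeb_set L M A \<union> loeb_set L M B"
  "A \<in> Alg L M \<Longrightarrow> B \<in> Alg L M \<Longrightarrow> loeb_set L M (cap L M A B) = loeb_set L M A \<inter> loeb_set L M B"
proof -
  show "loeb_set L M (empty_alg L M) = {}" "loeb_set L M (full_alg L M) = Om L M"
    using base by (auto simp: loeb_set_def pre_loeb_base_def)
  assume A: "A \<in> Alg L M"
  have sum1: "mem L M \<omega> A + mem L M \<omega> (compl L M A) = 1" if "\<omega> \<in> Om L M" for \<omega>
    using base A that by (auto simp: pre_loeb_base_def)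
  show "loeb_set L M (compl L M A) = Om L M - loeb_set L M A"
    using sum1 mem_cases[OF _ A] by (fastforce simp: loeb_set_def)
  assume B: "B \<in> Alg L M"
  have mm: "mem L M \<omega> (cup L M A B) = max (mem L M \<omega> A) (mem L M \<omega> B)"
    "mem L M \<omega> (cap L M A B) = min (mem L M \<omega> A) (mem L M \<omega> B)" if "\<omega> \<in> Om L M" for \<omega>
    using base A B that by (simp_all add: pre_loeb_base_def)
  show "loeb_set L M (cup L M A B) = loeb_set L M A \<union> loeb_set L M B"
    "loeb_set L M (cap L M A B) = loeb_set L M A \<inter> loeb_set L M B"
    using mm mem_cases[OF _ A] mem_cases[OF _ B] by (fastforce simp: loeb_set_def)+
qed

text \<open>The metric of the algebra sort is the supremum of the pointwise differences of
  membership, so elements with the same points have distance 0. The anchor makes the index set of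
  the supremum nonempty.\<close>

lemma loeb_set_inj: "inj_on (loeb_set L M) (Alg L M)"
proof (rule inj_onI)
  fix A B assume A: "A \<in> Alg L M" and B: "B \<in> Alg L M" and eq: "loeb_set L M A = loeb_set L M B"
  have "mem L M x A = mem L M x B" if "x \<in> Om L M" for x
    using mem_eq_indicator[OF that A] mem_eq_indicator[OF that B] eq by simp
  then have "(SUP x\<in>Om L M. \<bar>mem L M x A - mem L M x B\<bar>) = (SUP x\<in>Om L M. 0)"
    by (intro SUP_cong) auto
  also have "\<dots> = 0" using anchor_Om by (intro cSUP_const) auto
  finally have "sdist M (Alg_sort L) A B = 0"
    using base A B by (simp add: pre_loeb_base_def)
  then show "A = B" using A B by (simp add: Alg_def)
qed

lemma algebra_loeb_set: "algebra (Om L M) (loeb_set L M ` Alg L M)"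
  unfolding algebra_iff_Un
proof (intro conjI ballI)
  show "loeb_set L M ` Alg L M \<subseteq> Pow (Om L M)" by (auto simp: loeb_set_def)
  show "{} \<in> loeb_set L M ` Alg L M" using alg_closed(1) loeb_set_simps(1) by (metis imageI)
  fix a assume "a \<in> loeb_set L M ` Alg L M"
  then obtain A where A: "A \<in> Alg L M" "a = loeb_set L M A" by blast
  show "Om L M - a \<in> loeb_set L M ` Alg L M"
    unfolding A(2) loeb_set_simps(3)[OF A(1), symmetric] using A(1) by (intro imageI alg_closed)
  fix b assume "b \<in> loeb_set L M ` Alg L M"
  then obtain B where B: "B \<in> Alg L M" "b = loeb_set L M B" by blast
  show "a \<union> b \<in> loeb_set L M ` Alg L M"
    unfolding A(2) B(2) loeb_set_simps(4)[OF A(1) B(1), symmetric] using A(1) B(1)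
    by (intro imageI alg_closed)
qed

end

section \<open>Compactness from saturation\<close>

locale loeb = pre_loeb L M
  for L :: "('s,'f,'z) loeb_signature_scheme" and M :: "('s,'f,'a) metric_structure" +
  assumes saturated: "saturated L M (cardSuc (card_sig L))"
begin

text \<open>The type \<open>{x \<in> A\<^sub>n | n}\<close> is realized because it has countably many parameters.\<close>

lemma loeb_set_compact:
  assumes A: "range A \<subseteq> Alg L M" and fip: "\<And>n::nat. (\<Inter>i\<le>n. loeb_set L M (A i)) \<noteq> {}"
  shows "(\<Inter>n. loeb_set L M (A n)) \<noteq> {}"
proof -
  define P where "P = range (\<lambda>n. (Alg_sort L, A n))"
  define x where "x = (Omega_sort L, 0 :: nat)"
  define \<phi> where "\<phi> n = Ge (App (Inl (mem_sym L)) [Var x, App (Inr (Alg_sort L, A n)) []]) 1" for n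
  have sat_\<phi>: "sat (expand M) e (\<phi> n) \<longleftrightarrow> mem L M (e x) (A n) \<ge> 1" for e n
    by (simp add: \<phi>_def expand_def mem_def)
  have P: "P \<subseteq> elements L M" "|P| <o cardSuc (card_sig L)"
    using A loeb_signature
    by (auto simp: P_def elements_def is_loeb_signature_def Alg_def intro!: countable_less_cardSuc_card_sig)
  have sort: "has_sort (with_params L P) (App (Inr p) []) (fst p)" if "p \<in> P" for p
    using has_sort.intros(2)[of "Inr p" "with_params L P" "[]"] that by (simp add: with_params_def)
  have "has_sort (with_params L P) (App (Inl (mem_sym L)) [Var x, App (Inr (Alg_sort L, A n)) []])
      (res_sort (with_params L P) (Inl (mem_sym L)))" for n
    using sort[of "(Alg_sort L, A n)"] loeb_signature
      has_sort.intros(1)[of "Omega_sort L" "with_params L P" 0]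
    by (intro has_sort.intros(2))
       (auto simp: with_params_def is_loeb_signature_def has_type_def x_def P_def)
  then have form: "is_formula (with_params L P) (\<phi> n)" for n
    using loeb_signature by (simp add: \<phi>_def with_params_def is_loeb_signature_def has_type_def)
  have fv: "free_vars (\<phi> n) \<subseteq> set [x]" for n
    by (simp add: \<phi>_def)
  \<comment> \<open>The sort is discrete, so the closed ball of radius 1 around the anchor is all of
    \<open>Om\<close>, and the quantifier bounded by 1 is unrestricted.\<close>
  have sup: "sdist M (Omega_sort L) (anchor M (Omega_sort L)) \<omega> \<le> 1" if "\<omega> \<in> Om L M" for \<omega>
  proof -
    have "discrete_sort M (Omega_sort L)" using base by (simp add: pre_loeb_base_def)
    then have "sdist M (Omega_sort L) (anchor M (Omega_sort L)) \<omega> \<in> {0, 1}"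
      using anchor_Om that unfolding discrete_sort_def Om_def by blast
    then show ?thesis by auto
  qed
  have ex: "approx_sat (expand M) e (exists_list 1 [x] (conj_list \<phi>s))"
    if ne: "\<phi>s \<noteq> []" and sub: "set \<phi>s \<subseteq> range \<phi>" for \<phi>s e
  proof -
    \<comment> \<open>Finitely many formulas mention finitely many indices; the intersection up to
      the largest of them contains a witness.\<close>
    obtain K where K: "finite K" "set \<phi>s = \<phi> ` K"
      using finite_subset_image[OF List.finite_set sub] by blast
    then have "i \<le> Max (insert 0 K)" if "i \<in> K" for i using that by simp
    with fip[of "Max (insert 0 K)"] obtain \<omega> where \<omega>: "\<And>i. i \<in> K \<Longrightarrow> \<omega> \<in> loeb_set L M (A i)" "\<omega> \<in> Om L M"
      by (fastforce simp: loeb_set_def)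
    have "sat (expand M) (e(x := \<omega>)) (conj_list \<phi>s)"
      using \<omega> K(2) by (auto simp: sat_conj_list[OF ne] sat_\<phi> loeb_set_def)
    then have "sat (expand M) e (exists_list 1 [x] (conj_list \<phi>s))"
      using \<omega>(2) sup anchor_Om by (auto simp: exists_list_def expand_def x_def Om_def intro!: bexI[of _ \<omega>])
    then show ?thesis by (auto simp: approx_sat_def intro: sat_approximation)
  qed
  have "\<exists>c. valuation L M c \<and> (\<forall>\<psi>\<in>range \<phi>. approx_sat (expand M) c \<psi>)"
    using saturated unfolding saturated_def
  proof (elim conjE allE impE)
    show "distinct [x]" "fst ` set [x] \<subseteq> sorts L" "\<forall>\<psi>\<in>range \<phi>. is_formula (with_params L P) \<psi> \<and> free_vars \<psi> \<subseteq> set [x]"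
      using form fv loeb_signature by (auto simp: x_def is_loeb_signature_def)
    show "\<exists>r>0. \<forall>\<phi>s. \<phi>s \<noteq> [] \<longrightarrow> set \<phi>s \<subseteq> range \<phi> \<longrightarrow>
        (\<forall>e. valuation L M e \<longrightarrow> approx_sat (expand M) e (exists_list r [x] (conj_list \<phi>s)))"
      using ex by (intro exI[of _ 1]) auto
  qed (rule P | assumption)+
  then obtain c where c: "valuation L M c" "\<And>n. approx_sat (expand M) c (\<phi> n)" by blast
  have cx: "c x \<in> Om L M"
    using c(1) loeb_signature by (simp add: valuation_def x_def is_loeb_signature_def Om_def)
  have "c x \<in> loeb_set L M (A n)" for n
  proof -
    \<comment> \<open>The type is realized only approximately. The bound 1/2 suffices because
      membership takes only the values 0 and 1.\<close>
    have "approximation (\<phi> n) (Ge (App (Inl (mem_sym L)) [Var x, App (Inr (Alg_sort L, A n)) []]) (1/2))"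
      unfolding \<phi>_def by (intro approximation.intros) simp
    from c(2)[unfolded approx_sat_def, rule_format, OF this] have "mem L M (c x) (A n) \<ge> 1/2"
      by (simp add: expand_def mem_def of_rat_divide)
    moreover have "mem L M (c x) (A n) = 0 \<or> mem L M (c x) (A n) = 1"
      using A by (intro mem_cases cx) auto
    ultimately show ?thesis using cx by (auto simp: loeb_set_def)
  qed
  then show ?thesis by blast
qed

lemma decseq_loeb_set_compact:
  assumes E: "range E \<subseteq> loeb_set L M ` Alg L M" "decseq E" "(\<Inter>n. E n) = {}"
  shows "\<exists>n::nat. E n = {}"
proof (rule ccontr)
  assume ne: "\<nexists>n. E n = {}"
  from E(1) have "\<forall>n. \<exists>A\<in>Alg L M. E n = loeb_set L M A" by blast
  then obtain A where A: "\<And>n. A n \<in> Alg L M" "\<And>n. E n = loeb_set L M (A n)" by metis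
  have "(\<Inter>i\<le>n. loeb_set L M (A i)) \<noteq> {}" for n
  proof -
    have "E n \<subseteq> (\<Inter>i\<le>n. loeb_set L M (A i))"
      using decseqD[OF E(2)] A(2) by fastforce
    with ne show ?thesis by blast
  qed
  then have "(\<Inter>n. loeb_set L M (A n)) \<noteq> {}"
    using A(1) by (intro loeb_set_compact) auto
  with E(3) A(2) show False by simp
qed

end

section \<open>The Loeb measure\<close>

context loeb
begin

lemma loeb_algebra_eq: "loeb_algebra L M = sigma_sets (Om L M) (loeb_set L M ` Alg L M)"
  by (simp add: loeb_algebra_def)

lemma loeb_set_in_loeb_algebra: "A \<in> Alg L M \<Longrightarrow> loeb_set L M A \<in> loeb_algebra L M"
  by (simp add: loeb_algebra_def)

lemma Om_in_image: "Om L M \<in> loeb_set L M ` Alg L M"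
  using alg_closed(2) loeb_set_simps(2) by (metis imageI)

lemma Int_stable_loeb_set: "Int_stable (loeb_set L M ` Alg L M)"
proof (rule Int_stableI)
  interpret algebra "Om L M" "loeb_set L M ` Alg L M" by (rule algebra_loeb_set)
  show "a \<inter> b \<in> loeb_set L M ` Alg L M" if "a \<in> loeb_set L M ` Alg L M" "b \<in> loeb_set L M ` Alg L M" for a b
    using that by (rule Int)
qed

text \<open>By injectivity, disjointness of sets becomes an identity between elements, to which the
  axioms on \<open>mu\<close> apply.\<close>

lemma cap_eq_empty_alg:
  assumes "A \<in> Alg L M" "B \<in> Alg L M" "loeb_set L M A \<inter> loeb_set L M B = {}"
  shows "cap L M A B = empty_alg L M"
  using assms by (intro inj_onD[OF loeb_set_inj] alg_closed) (auto simp: loeb_set_simps)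

text \<open>This carries \<open>mu\<close> over to sets along the injection \<open>loeb_set\<close>.
  The modular law becomes additivity because the meet of disjoint elements has value 0.\<close>

lemma mu_charge:
  assumes "mu_additive L M"
  obtains m where "\<And>A. A \<in> Alg L M \<Longrightarrow> m (loeb_set L M A) = mu L M A"
    "\<And>X Y. X \<in> loeb_set L M ` Alg L M \<Longrightarrow> Y \<in> loeb_set L M ` Alg L M \<Longrightarrow> X \<inter> Y = {} \<Longrightarrow>
       m (X \<union> Y) = m X + m Y"
proof
  let ?m = "\<lambda>X. mu L M (the_inv_into (Alg L M) (loeb_set L M) X)"
  show m: "?m (loeb_set L M A) = mu L M A" if "A \<in> Alg L M" for A
    using that by (simp add: the_inv_into_f_f[OF loeb_set_inj])
  fix X Y
  assume "X \<in> loeb_set L M ` Alg L M" "Y \<in> loeb_set L M ` Alg L M" and dis: "X \<inter> Y = {}"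
  then obtain A B where A: "A \<in> Alg L M" "X = loeb_set L M A" and B: "B \<in> Alg L M" "Y = loeb_set L M B"
    by blast
  have "cap L M A B = empty_alg L M"
    using dis A B by (intro cap_eq_empty_alg) auto
  then have "mu L M (cup L M A B) = mu L M A + mu L M B"
    using assms[unfolded mu_additive_def] A(1) B(1) by (metis add.right_neutral)
  then show "?m (X \<union> Y) = ?m X + ?m Y"
    using m[OF A(1)] m[OF B(1)] m[OF alg_closed(4)[OF A(1) B(1)]] A B by (simp add: loeb_set_simps)
qed

text \<open>This justifies the definite description: existence is the Caratheodory extension, and
  uniqueness holds because the internal sets form an intersection-stable generator containing
  \<open>Om\<close>, which has finite mass.\<close>

lemma pos_loeb_measure:
  assumes "pre_loeb_finite_measure L M"
  shows "is_pos_loeb_measure L M (pos_loeb_measure L M)"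
  unfolding pos_loeb_measure_def
proof (rule theI')
  interpret A: algebra "Om L M" "loeb_set L M ` Alg L M" by (rule algebra_loeb_set)
  have add: "mu_additive L M" and nonneg: "\<And>A. A \<in> Alg L M \<Longrightarrow> 0 \<le> mu L M A"
    using assms by (auto simp: pre_loeb_finite_measure_def)
  obtain m where m: "\<And>A. A \<in> Alg L M \<Longrightarrow> m (loeb_set L M A) = mu L M A"
    "\<And>X Y. X \<in> loeb_set L M ` Alg L M \<Longrightarrow> Y \<in> loeb_set L M ` Alg L M \<Longrightarrow> X \<inter> Y = {} \<Longrightarrow>
       m (X \<union> Y) = m X + m Y"
    using mu_charge[OF add] by blast
  obtain P where P: "finite_measure P" "space P = Om L M"
    "sets P = sigma_sets (Om L M) (loeb_set L M ` Alg L M)"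
    "\<And>A. A \<in> loeb_set L M ` Alg L M \<Longrightarrow> emeasure P A = ennreal (m A)"
    by (rule A.additive_extends_to_measure[of m])
       (use decseq_loeb_set_compact m nonneg in auto)
  have "emeasure P (Om L M) = ennreal (pos_norm L M)"
    using P(4)[OF Om_in_image] m(1)[OF alg_closed(2)] by (simp add: loeb_set_simps pos_norm_def)
  with P m have "is_pos_loeb_measure L M P"
    by (simp add: is_pos_loeb_measure_def loeb_algebra_def)
  moreover have "N = N'" if N: "is_pos_loeb_measure L M N" and N': "is_pos_loeb_measure L M N'" for N N'
  proof (rule measure_eqI_generator_eq[where A = "\<lambda>_. Om L M"])
    show "Int_stable (loeb_set L M ` Alg L M)" by (rule Int_stable_loeb_set)
  qed (use N N' A.space_closed Om_in_image in \<open>auto simp: is_pos_loeb_measure_def loeb_algebra_def\<close>)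
  ultimately show "\<exists>!N. is_pos_loeb_measure L M N" by blast
qed

text \<open>The description of the signed Loeb measure is met by the difference of the two measures
  from \<open>jordan_extension\<close>, and only by it. Most of the work is to identify their total
  mass with \<open>signed_norm\<close>.\<close>

lemma signed_loeb_measure:
  assumes "pre_loeb_signed_measure L M"
  obtains P N where "finite_measure P" "space P = Om L M" "sets P = loeb_algebra L M"
    "finite_measure N" "sets N = loeb_algebra L M"
    "\<And>E. E \<in> loeb_algebra L M \<Longrightarrow> signed_loeb_measure L M E = measure P E - measure N E"
    "\<And>A. A \<in> Alg L M \<Longrightarrow> signed_loeb_measure L M (loeb_set L M A) = mu L M A"
proof -
  interpret A: algebra "Om L M" "loeb_set L M ` Alg L M" by (rule algebra_loeb_set)
  have add: "mu_additive L M" and bdd: "bdd_above (signed_norm_set L M)"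
    using assms by (auto simp: pre_loeb_signed_measure_def)
  have mu0: "mu L M (empty_alg L M) = 0" using add by (simp add: mu_additive_def)
  obtain m where m: "\<And>A. A \<in> Alg L M \<Longrightarrow> m (loeb_set L M A) = mu L M A"
    "\<And>X Y. X \<in> loeb_set L M ` Alg L M \<Longrightarrow> Y \<in> loeb_set L M ` Alg L M \<Longrightarrow> X \<inter> Y = {} \<Longrightarrow>
       m (X \<union> Y) = m X + m Y"
    using mu_charge[OF add] by blast
  have norm_upper: "\<bar>mu L M A\<bar> + \<bar>mu L M B\<bar> - \<bar>mu L M (cap L M A B)\<bar> \<le> signed_norm L M"
    if "A \<in> Alg L M" "B \<in> Alg L M" for A B
    unfolding signed_norm_def using that bdd by (intro cSup_upper) (auto simp: signed_norm_set_def)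
  \<comment> \<open>For disjoint elements the subtracted term is \<open>mu\<close> of the empty
    element, hence 0. Taking one of the two empty bounds the charge; taking complements bounds the
    total mass.\<close>
  have norm_disjoint: "\<bar>mu L M A\<bar> + \<bar>mu L M B\<bar> \<le> signed_norm L M"
    if "A \<in> Alg L M" "B \<in> Alg L M" "loeb_set L M A \<inter> loeb_set L M B = {}" for A B
    using norm_upper[OF that(1,2)] cap_eq_empty_alg[OF that] mu0 by simp
  interpret bounded_charge "Om L M" "loeb_set L M ` Alg L M" m "signed_norm L M"
  proof
    show "\<bar>m E\<bar> \<le> signed_norm L M" if "E \<in> loeb_set L M ` Alg L M" for E
      using that norm_disjoint[OF _ alg_closed(1)] m(1) mu0 by (auto simp: loeb_set_simps)
  qed (rule m(2))
  obtain P N where PN: "finite_measure P" "finite_measure N" "space P = Om L M" "space N = Om L M"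
    "sets P = loeb_algebra L M" "sets N = loeb_algebra L M"
    and diff: "\<And>E. E \<in> loeb_set L M ` Alg L M \<Longrightarrow> m E = measure P E - measure N E"
    and least: "\<And>x. (\<And>E. E \<in> loeb_set L M ` Alg L M \<Longrightarrow> m E - m (Om L M - E) \<le> x) \<Longrightarrow>
       measure P (Om L M) + measure N (Om L M) \<le> x"
    unfolding loeb_algebra_eq by (rule jordan_extension) (use decseq_loeb_set_compact in auto)
  interpret P: finite_measure P by fact
  interpret N: finite_measure N by fact
  define \<nu> where "\<nu> E = measure P E - measure N E" for E
  have \<nu>: "\<nu> (loeb_set L M A) = mu L M A" if "A \<in> Alg L M" for A
    using diff m(1) that by (auto simp: \<nu>_def)
  have sm: "is_signed_measure (Om L M) (loeb_algebra L M) \<nu>"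
    unfolding \<nu>_def[abs_def] by (rule is_signed_measure_diff) (rule PN)+
  have "measure P (Om L M) + measure N (Om L M) \<le> signed_norm L M"
  proof (rule least)
    fix E assume "E \<in> loeb_set L M ` Alg L M"
    then obtain A where A: "A \<in> Alg L M" "E = loeb_set L M A" by blast
    have c: "loeb_set L M (compl L M A) = Om L M - loeb_set L M A" using A by (simp add: loeb_set_simps)
    have "\<bar>mu L M A\<bar> + \<bar>mu L M (compl L M A)\<bar> \<le> signed_norm L M"
      using A c by (intro norm_disjoint alg_closed) auto
    then show "m E - m (Om L M - E) \<le> signed_norm L M"
      using m(1)[OF A(1)] m(1)[OF alg_closed(3)[OF A(1)]] A c by simp
  qed
  \<comment> \<open>With \<open>a\<close>, \<open>b\<close>, \<open>c\<close> the values of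
    \<open>\<nu>\<close> on \<open>?A - ?B\<close>, \<open>?B - ?A\<close> and
    \<open>?A \<inter> ?B\<close>, a member of the norm set is \<open>\<bar>a + c\<bar> + \<bar>b +
    c\<bar> - \<bar>c\<bar> \<le> \<bar>a\<bar> + \<bar>b\<bar> + \<bar>c\<bar>\<close>, and each
    term is bounded by the mass of its piece.\<close>
  moreover have "signed_norm L M \<le> measure P (Om L M) + measure N (Om L M)"
    unfolding signed_norm_def
  proof (rule cSup_least)
    show "signed_norm_set L M \<noteq> {}" using alg_closed(1) by (auto simp: signed_norm_set_def)
    fix x assume "x \<in> signed_norm_set L M"
    then obtain A B where A: "A \<in> Alg L M" and B: "B \<in> Alg L M"
      and x: "x = \<bar>mu L M A\<bar> + \<bar>mu L M B\<bar> - \<bar>mu L M (cap L M A B)\<bar>"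
      by (auto simp: signed_norm_set_def)
    let ?A = "loeb_set L M A" and ?B = "loeb_set L M B"
    have split: "measure Q ?A = measure Q (?A - ?B) + measure Q (?A \<inter> ?B) \<and>
        measure Q ?B = measure Q (?B - ?A) + measure Q (?A \<inter> ?B) \<and>
        measure Q (?A - ?B) + measure Q (?B - ?A) + measure Q (?A \<inter> ?B) \<le> measure Q (Om L M)"
      if "finite_measure Q" "space Q = Om L M" "sets Q = loeb_algebra L M" for Q
    proof -
      interpret Q: finite_measure Q by fact
      have AB: "?A \<in> sets Q" "?B \<in> sets Q"
        using A B that by (simp_all add: loeb_set_in_loeb_algebra)
      have "measure Q ?A = measure Q ((?A - ?B) \<union> (?A \<inter> ?B))"
        by (intro arg_cong[of _ _ "measure Q"]) auto
      also have "\<dots> = measure Q (?A - ?B) + measure Q (?A \<inter> ?B)"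
        using AB by (intro Q.finite_measure_Union) auto
      finally have 1: "measure Q ?A = measure Q (?A - ?B) + measure Q (?A \<inter> ?B)" .
      have "measure Q ?B = measure Q ((?B - ?A) \<union> (?A \<inter> ?B))"
        by (intro arg_cong[of _ _ "measure Q"]) auto
      also have "\<dots> = measure Q (?B - ?A) + measure Q (?A \<inter> ?B)"
        using AB by (intro Q.finite_measure_Union) auto
      finally have 2: "measure Q ?B = measure Q (?B - ?A) + measure Q (?A \<inter> ?B)" .
      have "measure Q ?A + measure Q (?B - ?A) = measure Q (?A \<union> (?B - ?A))"
        using AB by (intro Q.finite_measure_Union[symmetric]) auto
      also have "\<dots> \<le> measure Q (Om L M)"
        using Q.bounded_measure that(2) by simp
      finally show ?thesis using 1 2 by simp
    qed
    have "\<nu> ?A = mu L M A" "\<nu> ?B = mu L M B" "\<nu> (?A \<inter> ?B) = mu L M (cap L M A B)"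
      using \<nu>[OF A] \<nu>[OF B] \<nu>[OF alg_closed(5)[OF A B]] A B by (simp_all add: loeb_set_simps)
    then show "x \<le> measure P (Om L M) + measure N (Om L M)"
      unfolding x \<nu>_def using split[OF PN(1,3,5)] split[OF PN(2,4,6)]
        measure_nonneg[of P "?A - ?B"] measure_nonneg[of P "?B - ?A"] measure_nonneg[of P "?A \<inter> ?B"]
        measure_nonneg[of N "?A - ?B"] measure_nonneg[of N "?B - ?A"] measure_nonneg[of N "?A \<inter> ?B"]
      by linarith
  qed
  ultimately have "measure P (Om L M) + measure N (Om L M) = signed_norm L M" by simp
  moreover have "total_variation (Om L M) (loeb_algebra L M) \<nu> =
      ennreal (measure P (Om L M) + measure N (Om L M))"
  proof (rule total_variation_diff[OF PN(1,3,5,2,6), where G = "loeb_set L M ` Alg L M"])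
    fix x assume x: "\<And>E. E \<in> loeb_set L M ` Alg L M \<Longrightarrow> \<nu> E - \<nu> (Om L M - E) \<le> x"
    show "measure P (Om L M) + measure N (Om L M) \<le> x"
      using x diff A.compl_sets by (intro least) (auto simp: \<nu>_def)
  qed (use anchor_Om loeb_set_in_loeb_algebra in \<open>auto simp: \<nu>_def\<close>)
  ultimately have loeb: "is_signed_loeb_measure L M \<nu>"
    using sm \<nu> by (simp add: is_signed_loeb_measure_def)
  have "signed_loeb_measure L M = \<nu>"
    unfolding signed_loeb_measure_def
  proof (rule the_equality)
    fix \<nu>' assume \<nu>': "is_signed_loeb_measure L M \<nu>'"
    show "\<nu>' = \<nu>"
    proof (rule signed_measure_eqI)
      show "is_signed_measure (Om L M) (loeb_algebra L M) \<nu>'"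
        using \<nu>' by (simp add: is_signed_loeb_measure_def)
      show "loeb_algebra L M = sigma_sets (Om L M) (loeb_set L M ` Alg L M)"
        by (rule loeb_algebra_eq)
    qed (use \<nu>' \<nu> sm Int_stable_loeb_set A.space_closed Om_in_image in \<open>auto simp: is_signed_loeb_measure_def\<close>)
  qed (rule loeb)
  then show thesis
    using that[OF PN(1,3,5,2,6)] \<nu> by (simp add: \<nu>_def)
qed

end

section \<open>Representation of the integral\<close>

locale pre_integration = loeb L M
  for L :: "('s,'f,'z) integration_signature_scheme" and M :: "('s,'f,'a) metric_structure" +
  assumes integration_signature: "is_integration_signature L"
    and integration_base: "pre_integration_base L M"
begin

lemma ladd_Linf: "f \<in> Linf L M \<Longrightarrow> g \<in> Linf L M \<Longrightarrow> ladd L M f g \<in> Linf L M"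
  and lsub_Linf: "f \<in> Linf L M \<Longrightarrow> g \<in> Linf L M \<Longrightarrow> lsub L M f g \<in> Linf L M"
  and lscale_Linf: "f \<in> Linf L M \<Longrightarrow> lscale L M a f \<in> Linf L M"
  and dist_Linf: "f \<in> Linf L M \<Longrightarrow> g \<in> Linf L M \<Longrightarrow> sdist M (Linf_sort L) f g = lnorm L M (lsub L M f g)"
proof -
  have "banach_space_on (sort_metric M (Linf_sort L)) (ladd L M) (lsub L M) (lscale L M) (lzero L M) (lnorm L M)"
    using integration_base by (simp add: pre_integration_base_def banach_algebra_on_def)
  note space = this[unfolded banach_space_on_def Let_def, folded Linf_def]
  have add: "\<forall>x\<in>Linf L M. \<forall>y\<in>Linf L M. ladd L M x y \<in> Linf L M \<and> lsub L M x y \<in> Linf L M"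
    using space by (elim conjE)
  have scale: "\<forall>a. \<forall>x\<in>Linf L M. lscale L M a x \<in> Linf L M"
    using space by (elim conjE)
  have dist: "\<forall>x\<in>Linf L M. \<forall>y\<in>Linf L M. sdist M (Linf_sort L) x y = lnorm L M (lsub L M x y)"
    using space by (elim conjE)
  show "ladd L M f g \<in> Linf L M" if "f \<in> Linf L M" "g \<in> Linf L M" using add that by blast
  show "lsub L M f g \<in> Linf L M" if "f \<in> Linf L M" "g \<in> Linf L M" using add that by blast
  show "lscale L M a f \<in> Linf L M" if "f \<in> Linf L M" using scale that by blast
  show "sdist M (Linf_sort L) f g = lnorm L M (lsub L M f g)" if "f \<in> Linf L M" "g \<in> Linf L M"
    using dist that by blast
qed

lemma chi_Linf: "A \<in> Alg L M \<Longrightarrow> chi L M A \<in> Linf L M"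
  unfolding chi_def Linf_def
  by (rule interp_in_univ[OF metric_structure];
      use integration_signature in \<open>force simp: is_integration_signature_def has_type_def Alg_def\<close>)

lemma ev_simps:
  assumes "\<omega> \<in> Om L M"
  shows "f \<in> Linf L M \<Longrightarrow> g \<in> Linf L M \<Longrightarrow> ev L M (ladd L M f g) \<omega> = ev L M f \<omega> + ev L M g \<omega>"
    "f \<in> Linf L M \<Longrightarrow> g \<in> Linf L M \<Longrightarrow> ev L M (lsub L M f g) \<omega> = ev L M f \<omega> - ev L M g \<omega>"
    "f \<in> Linf L M \<Longrightarrow> ev L M (lscale L M a f) \<omega> = a * ev L M f \<omega>"
    "A \<in> Alg L M \<Longrightarrow> ev L M (chi L M A) \<omega> = indicator (loeb_set L M A) \<omega>"
proof -
  note base = integration_base[unfolded pre_integration_base_def]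
  have ops: "\<forall>\<omega>\<in>Om L M. \<forall>f\<in>Linf L M. \<forall>g\<in>Linf L M.
      ev L M (ladd L M f g) \<omega> = ev L M f \<omega> + ev L M g \<omega> \<and>
      ev L M (lsub L M f g) \<omega> = ev L M f \<omega> - ev L M g \<omega> \<and>
      ev L M (lmul L M f g) \<omega> = ev L M f \<omega> * ev L M g \<omega> \<and>
      ev L M (lmeet L M f g) \<omega> = min (ev L M f \<omega>) (ev L M g \<omega>) \<and>
      ev L M (ljoin L M f g) \<omega> = max (ev L M f \<omega>) (ev L M g \<omega>)"
    using base by (elim conjE)
  have scale: "\<forall>\<omega>\<in>Om L M. \<forall>a. \<forall>f\<in>Linf L M. ev L M (lscale L M a f) \<omega> = a * ev L M f \<omega>"
    using base by (elim conjE)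
  have chi: "\<forall>A\<in>Alg L M. \<forall>\<omega>\<in>Om L M. ev L M (chi L M A) \<omega> = mem L M \<omega> A"
    using base by (elim conjE)
  show "ev L M (ladd L M f g) \<omega> = ev L M f \<omega> + ev L M g \<omega>" if "f \<in> Linf L M" "g \<in> Linf L M"
    using ops assms that by blast
  show "ev L M (lsub L M f g) \<omega> = ev L M f \<omega> - ev L M g \<omega>" if "f \<in> Linf L M" "g \<in> Linf L M"
    using ops assms that by blast
  show "ev L M (lscale L M a f) \<omega> = a * ev L M f \<omega>" if "f \<in> Linf L M"
    using scale assms that by blast
  assume A: "A \<in> Alg L M"
  then have "ev L M (chi L M A) \<omega> = mem L M \<omega> A"
    using chi assms by blast
  then show "ev L M (chi L M A) \<omega> = indicator (loeb_set L M A) \<omega>"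
    using mem_eq_indicator[OF assms A] by simp
qed

lemma ev_bounds:
  assumes "f \<in> Linf L M"
  obtains a b where "\<And>\<omega>. \<omega> \<in> Om L M \<Longrightarrow> a \<le> ev L M f \<omega>" "\<And>\<omega>. \<omega> \<in> Om L M \<Longrightarrow> ev L M f \<omega> \<le> b"
proof -
  have "bdd_above (ev L M f ` Om L M)" "bdd_below (ev L M f ` Om L M)"
    using integration_base assms by (auto simp: pre_integration_base_def)
  then show thesis using that by (auto simp: bdd_above_def bdd_below_def)
qed

lemma approximately_measurable:
  assumes "f \<in> Linf L M" "u < v"
  obtains A where "A \<in> Alg L M" "\<And>\<omega>. \<omega> \<in> loeb_set L M A \<Longrightarrow> ev L M f \<omega> \<le> v"
    "\<And>\<omega>. \<omega> \<in> Om L M - loeb_set L M A \<Longrightarrow> u \<le> ev L M f \<omega>"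
proof -
  obtain A where A: "A \<in> Alg L M" "\<And>\<omega>. \<omega> \<in> Om L M \<Longrightarrow>
      (mem L M \<omega> A = 1 \<longrightarrow> ev L M f \<omega> \<le> v) \<and> (mem L M \<omega> A = 0 \<longrightarrow> u \<le> ev L M f \<omega>)"
    using integration_base assms unfolding pre_integration_base_def by blast
  show thesis
    by (rule that[OF A(1)]) (use A(2) mem_cases[OF _ A(1)] in \<open>auto simp: loeb_set_def\<close>)
qed

text \<open>The sublevel set at \<open>a\<close> is the intersection of internal sets
  \<open>A n\<close> separating the levels \<open>a + 1/(n+2)\<close> and
  \<open>a + 1/(n+1)\<close>. Off \<open>A n\<close> the function exceeds \<open>a\<close>; on all
  \<open>A n\<close> it is at most \<open>a + 1/(n+1)\<close> for every \<open>n\<close>.\<close>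

lemma ev_measurable:
  assumes Q: "space Q = Om L M" "sets Q = loeb_algebra L M" and f: "f \<in> Linf L M"
  shows "ev L M f \<in> borel_measurable Q"
  unfolding borel_measurable_iff_le
proof
  fix a :: real
  have lt: "a + 1 / real (n + 2) < a + 1 / real (n + 1)" for n
    by (simp add: frac_less2)
  have "\<exists>A. A \<in> Alg L M \<and> (\<forall>\<omega>\<in>loeb_set L M A. ev L M f \<omega> \<le> a + 1 / real (n + 1)) \<and>
     (\<forall>\<omega>\<in>Om L M - loeb_set L M A. a + 1 / real (n + 2) \<le> ev L M f \<omega>)" for n
    by (rule approximately_measurable[OF f lt[of n]]) blast
  then obtain A where A: "\<And>n. A n \<in> Alg L M"
    "\<And>n \<omega>. \<omega> \<in> loeb_set L M (A n) \<Longrightarrow> ev L M f \<omega> \<le> a + 1 / real (n + 1)"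
    "\<And>n \<omega>. \<omega> \<in> Om L M - loeb_set L M (A n) \<Longrightarrow> a + 1 / real (n + 2) \<le> ev L M f \<omega>"
    by metis
  have "{\<omega> \<in> space Q. ev L M f \<omega> \<le> a} = (\<Inter>n. loeb_set L M (A n))"
  proof (intro equalityI subsetI)
    fix \<omega> assume "\<omega> \<in> {\<omega> \<in> space Q. ev L M f \<omega> \<le> a}"
    then have \<omega>: "\<omega> \<in> Om L M" "ev L M f \<omega> \<le> a" using Q by auto
    show "\<omega> \<in> (\<Inter>n. loeb_set L M (A n))"
    proof (rule INT_I, rule ccontr)
      fix n assume "\<omega> \<notin> loeb_set L M (A n)"
      then have "a + 1 / real (n + 2) \<le> ev L M f \<omega>" using \<omega> A(3) by auto
      moreover have "0 < 1 / real (n + 2)" by simp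
      ultimately show False using \<omega> by linarith
    qed
  next
    fix \<omega> assume \<omega>: "\<omega> \<in> (\<Inter>n. loeb_set L M (A n))"
    have "ev L M f \<omega> \<le> a + inverse (real (Suc n))" for n
      using A(2)[of \<omega> n] \<omega> by (auto simp: inverse_eq_divide add.commute)
    then have "ev L M f \<omega> \<le> a"
      by (intro LIMSEQ_le_const[OF LIMSEQ_inverse_real_of_nat_add]) auto
    then show "\<omega> \<in> {\<omega> \<in> space Q. ev L M f \<omega> \<le> a}"
      using \<omega> Q by (auto simp: loeb_set_def)
  qed
  also have "\<dots> \<in> sets Q"
    using A(1) Q(2) loeb_set_in_loeb_algebra by (intro sets.countable_INT) auto
  finally show "{\<omega> \<in> space Q. ev L M f \<omega> \<le> a} \<in> sets Q" .
qed

lemma ev_integrable: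
  assumes Q: "finite_measure Q" "space Q = Om L M" "sets Q = loeb_algebra L M" and f: "f \<in> Linf L M"
  shows "integrable Q (ev L M f)"
proof -
  interpret finite_measure Q by fact
  obtain a b where "\<And>\<omega>. \<omega> \<in> Om L M \<Longrightarrow> a \<le> ev L M f \<omega>" "\<And>\<omega>. \<omega> \<in> Om L M \<Longrightarrow> ev L M f \<omega> \<le> b"
    using ev_bounds[OF f] by blast
  then have "AE \<omega> in Q. norm (ev L M f \<omega>) \<le> max \<bar>a\<bar> \<bar>b\<bar>"
    using Q(2) by (intro AE_I2) fastforce
  then show ?thesis by (rule integrable_const_bound) (rule ev_measurable[OF Q(2,3) f])
qed

end

section \<open>Comparison of \<open>I\<close> with the integral against a difference of
  measures\<close>

lemma (in finite_measure) integral_diff_le: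
  assumes "integrable M f" "integrable M g" "\<And>x. x \<in> space M \<Longrightarrow> \<bar>f x - g x\<bar> \<le> (e::real)"
  shows "\<bar>integral\<^sup>L M f - integral\<^sup>L M g\<bar> \<le> e * measure M (space M)"
proof -
  have "\<bar>integral\<^sup>L M f - integral\<^sup>L M g\<bar> = \<bar>\<integral>x. f x - g x \<partial>M\<bar>"
    using assms by simp
  also have "\<dots> \<le> (\<integral>x. \<bar>f x - g x\<bar> \<partial>M)"
    by (rule integral_abs_bound)
  also have "\<dots> \<le> (\<integral>x. e \<partial>M)"
    using assms by (intro integral_mono) auto
  finally show ?thesis by (simp add: mult.commute)
qed

text \<open>A common setting for both cases: for a positive structure \<open>N\<close> is the null
  measure, for a signed one \<open>P\<close> and \<open>N\<close> are the Jordan parts.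
  \<open>K\<close> stands for the norm of \<open>mu\<close> in either sense.\<close>

locale charge_representation = pre_integration L M +
  P: finite_measure P + N: finite_measure N
  for L :: "('s,'f,'z) integration_signature_scheme" and M :: "('s,'f,'a) metric_structure"
    and P N :: "'a elem measure" +
  fixes K :: real
  assumes spaces: "space P = Om L M" "space N = Om L M"
    and sets: "sets P = loeb_algebra L M" "sets N = loeb_algebra L M"
    and mu_diff: "A \<in> Alg L M \<Longrightarrow> mu L M A = measure P (loeb_set L M A) - measure N (loeb_set L M A)"
    and mu_eq: "A \<in> Alg L M \<Longrightarrow> mu L M A = Ifun L M (chi L M A)"
    and lipschitz: "lipschitz_linear_functional L M K"
begin

lemma Ifun_ladd: "f \<in> Linf L M \<Longrightarrow> g \<in> Linf L M \<Longrightarrow> Ifun L M (ladd L M f g) = Ifun L M f + Ifun L M g"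
  and Ifun_lscale: "f \<in> Linf L M \<Longrightarrow> Ifun L M (lscale L M a f) = a * Ifun L M f"
  and Ifun_dist: "f \<in> Linf L M \<Longrightarrow> g \<in> Linf L M \<Longrightarrow>
    \<bar>Ifun L M f - Ifun L M g\<bar> \<le> K * sdist M (Linf_sort L) f g"
  using lipschitz by (auto simp: lipschitz_linear_functional_def)

definition J :: "'a elem \<Rightarrow> real" where
  "J f = (\<integral>\<omega>. ev L M f \<omega> \<partial>P) - (\<integral>\<omega>. ev L M f \<omega> \<partial>N)"

lemmas integrable_P = ev_integrable[OF P.finite_measure_axioms spaces(1) sets(1)]
lemmas integrable_N = ev_integrable[OF N.finite_measure_axioms spaces(2) sets(2)]

lemma J_ladd:
  assumes "f \<in> Linf L M" "g \<in> Linf L M"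
  shows "J (ladd L M f g) = J f + J g"
proof -
  have "(\<integral>\<omega>. ev L M (ladd L M f g) \<omega> \<partial>Q) = (\<integral>\<omega>. ev L M f \<omega> \<partial>Q) + (\<integral>\<omega>. ev L M g \<omega> \<partial>Q)"
    if "space Q = Om L M" "integrable Q (ev L M f)" "integrable Q (ev L M g)" for Q
  proof -
    have "(\<integral>\<omega>. ev L M (ladd L M f g) \<omega> \<partial>Q) = (\<integral>\<omega>. ev L M f \<omega> + ev L M g \<omega> \<partial>Q)"
      using that assms by (intro Bochner_Integration.integral_cong) (auto simp: ev_simps)
    with that show ?thesis by simp
  qed
  from this[OF spaces(1) integrable_P integrable_P] this[OF spaces(2) integrable_N integrable_N] assms
  show ?thesis by (simp add: J_def)
qed

lemma J_lscale_chi: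
  assumes A: "A \<in> Alg L M"
  shows "J (lscale L M a (chi L M A)) = a * mu L M A"
proof -
  have "(\<integral>\<omega>. ev L M (lscale L M a (chi L M A)) \<omega> \<partial>Q) = a * measure Q (loeb_set L M A)"
    if "space Q = Om L M" "sets Q = loeb_algebra L M" for Q
  proof -
    have sub: "loeb_set L M A \<subseteq> space Q" using that by (auto simp: loeb_set_def)
    have "(\<integral>\<omega>. ev L M (lscale L M a (chi L M A)) \<omega> \<partial>Q) =
        (\<integral>\<omega>. a * indicator (loeb_set L M A) \<omega> \<partial>Q)"
      using that chi_Linf[OF A] A by (intro Bochner_Integration.integral_cong) (auto simp: ev_simps)
    then show ?thesis using sub by (simp add: Int_absorb2)
  qed
  from this[OF spaces(1) sets(1)] this[OF spaces(2) sets(2)] show ?thesis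
    by (simp add: J_def mu_diff[OF A] right_diff_distrib)
qed

lemma Ifun_lscale_chi: "A \<in> Alg L M \<Longrightarrow> Ifun L M (lscale L M a (chi L M A)) = a * mu L M A"
  by (simp add: Ifun_lscale chi_Linf mu_eq)

text \<open>
  With \<open>A k\<close> separating the levels \<open>c + k * e\<close> and \<open>c + (k + 1) * e\<close> of \<open>f\<close>, the element \<open>g\<close> is
  \<open>c\<close> plus the sum of \<open>e * \<chi> (compl (A k))\<close> over \<open>k < n\<close>. The last alternative distinguishes
  whether \<open>\<omega>\<close> lies in none or in some of the \<open>A k\<close>.
\<close>

lemma step_approximation:
  assumes f: "f \<in> Linf L M" and e: "0 < e" and c: "\<And>\<omega>. \<omega> \<in> Om L M \<Longrightarrow> c \<le> ev L M f \<omega>"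
  shows "\<exists>g\<in>Linf L M. Ifun L M g = J g \<and> (\<forall>\<omega>\<in>Om L M. ev L M g \<omega> \<le> c + real n * e \<and>
    ev L M g \<omega> \<le> ev L M f \<omega> + e \<and> (ev L M g \<omega> = c + real n * e \<or> ev L M f \<omega> - e \<le> ev L M g \<omega>))"
proof (induction n)
  case 0
  let ?g = "lscale L M c (chi L M (full_alg L M))"
  have "ev L M ?g \<omega> = c" if "\<omega> \<in> Om L M" for \<omega>
    using that alg_closed(2) by (simp add: ev_simps chi_Linf loeb_set_simps)
  moreover have "?g \<in> Linf L M"
    by (intro lscale_Linf chi_Linf alg_closed)
  moreover have "Ifun L M ?g = J ?g"
    using alg_closed(2) by (simp add: J_lscale_chi Ifun_lscale_chi)
  ultimately show ?case
    using c e by (intro bexI[of _ ?g]) (auto intro: add_increasing2)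
next
  case (Suc n)
  then obtain g where g: "g \<in> Linf L M" "Ifun L M g = J g"
    and upper: "\<And>\<omega>. \<omega> \<in> Om L M \<Longrightarrow> ev L M g \<omega> \<le> c + real n * e"
      "\<And>\<omega>. \<omega> \<in> Om L M \<Longrightarrow> ev L M g \<omega> \<le> ev L M f \<omega> + e"
    and alt: "\<And>\<omega>. \<omega> \<in> Om L M \<Longrightarrow> ev L M g \<omega> = c + real n * e \<or> ev L M f \<omega> - e \<le> ev L M g \<omega>"
    by blast
  have "c + real n * e < c + real (Suc n) * e" using e by (simp add: algebra_simps)
  then obtain A where A: "A \<in> Alg L M"
    and below: "\<And>\<omega>. \<omega> \<in> loeb_set L M A \<Longrightarrow> ev L M f \<omega> \<le> c + real (Suc n) * e"
    and above: "\<And>\<omega>. \<omega> \<in> Om L M - loeb_set L M A \<Longrightarrow> c + real n * e \<le> ev L M f \<omega>"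
    using approximately_measurable[OF f] by blast
  let ?h = "lscale L M e (chi L M (compl L M A))"
  have cA: "compl L M A \<in> Alg L M" using A by (rule alg_closed)
  have h: "?h \<in> Linf L M" by (intro lscale_Linf chi_Linf cA)
  have "Ifun L M (ladd L M g ?h) = J (ladd L M g ?h)"
    using g h cA by (simp add: Ifun_ladd J_ladd Ifun_lscale_chi J_lscale_chi)
  moreover have "ev L M (ladd L M g ?h) \<omega> \<le> c + real (Suc n) * e \<and>
      ev L M (ladd L M g ?h) \<omega> \<le> ev L M f \<omega> + e \<and>
      (ev L M (ladd L M g ?h) \<omega> = c + real (Suc n) * e \<or> ev L M f \<omega> - e \<le> ev L M (ladd L M g ?h) \<omega>)"
    if \<omega>: "\<omega> \<in> Om L M" for \<omega>
  proof -
    have ev: "ev L M (ladd L M g ?h) \<omega> = ev L M g \<omega> + e * indicator (Om L M - loeb_set L M A) \<omega>"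
      using \<omega> g h cA A by (simp add: ev_simps chi_Linf loeb_set_simps)
    have S: "c + real (Suc n) * e = c + real n * e + e" by (simp add: algebra_simps)
    \<comment> \<open>Inside \<open>A\<close> the value of \<open>g\<close> is kept; if it is the
      old top level, then \<open>f\<close> is at most one step above it. Outside \<open>A\<close>
      the value rises by \<open>e\<close>, and the bound \<open>f + e\<close> survives because
      \<open>f\<close> is at least the old top level, which bounds \<open>g\<close>.\<close>
    show ?thesis
    proof (cases "\<omega> \<in> loeb_set L M A")
      case True
      with upper[OF \<omega>] alt[OF \<omega>] below[OF True] e show ?thesis unfolding ev S by auto
    next
      case False
      with upper[OF \<omega>] alt[OF \<omega>] above[of \<omega>] \<omega> e show ?thesis unfolding ev S by auto
    qed
  qed
  ultimately show ?case using ladd_Linf[OF g(1) h] by blast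
qed

theorem Ifun_eq_J:
  assumes f: "f \<in> Linf L M"
  shows "Ifun L M f = J f"
proof -
  define V where "V = measure P (Om L M) + measure N (Om L M)"
  have bound: "\<bar>Ifun L M f - J f\<bar> \<le> e" if e: "0 < e" for e
  proof -
    \<comment> \<open>Replacing \<open>f\<close> by a \<open>d\<close>-close element changes
      \<open>I\<close> by at most \<open>\<bar>K\<bar> * d\<close> and \<open>J\<close> by at most
      \<open>d * V\<close>; the summand 1 keeps the denominator positive.\<close>
    define d where "d = e / (\<bar>K\<bar> + V + 1)"
    have V: "0 \<le> V" by (simp add: V_def)
    have d: "0 < d" using e V by (simp add: d_def)
    have de: "d * (\<bar>K\<bar> + V) \<le> e"
    proof -
      have "d * (\<bar>K\<bar> + V) \<le> d * (\<bar>K\<bar> + V + 1)" using d by simp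
      also have "\<dots> = e" using V by (simp add: d_def)
      finally show ?thesis .
    qed
    obtain c b where c: "\<And>\<omega>. \<omega> \<in> Om L M \<Longrightarrow> c \<le> ev L M f \<omega>"
      and b: "\<And>\<omega>. \<omega> \<in> Om L M \<Longrightarrow> ev L M f \<omega> \<le> b"
      using ev_bounds[OF f] by blast
    \<comment> \<open>With the top level \<open>c + n * d\<close> above \<open>f\<close>, both
      alternatives of \<open>step_approximation\<close> give \<open>f - d \<le> g\<close>.\<close>
    obtain n where "b - c < real n * d" using ex_less_of_nat_mult[OF d] by blast
    then have n: "ev L M f \<omega> \<le> c + real n * d" if "\<omega> \<in> Om L M" for \<omega>
      using b[OF that] by simp
    obtain g where g: "g \<in> Linf L M" "Ifun L M g = J g"
      and close: "\<And>\<omega>. \<omega> \<in> Om L M \<Longrightarrow> ev L M g \<omega> \<le> ev L M f \<omega> + d \<and>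
        (ev L M g \<omega> = c + real n * d \<or> ev L M f \<omega> - d \<le> ev L M g \<omega>)"
      using step_approximation[OF f d c, of n] by blast
    have close: "\<bar>ev L M f \<omega> - ev L M g \<omega>\<bar> \<le> d" if "\<omega> \<in> Om L M" for \<omega>
      using close[OF that] n[OF that] d by auto
    have "sdist M (Linf_sort L) f g = (SUP \<omega>\<in>Om L M. \<bar>ev L M (lsub L M f g) \<omega>\<bar>)"
      using dist_Linf[OF f g(1)] integration_base lsub_Linf[OF f g(1)]
      by (simp add: pre_integration_base_def)
    also have "\<dots> \<le> d"
      using anchor_Om close f g by (intro cSUP_least) (auto simp: ev_simps)
    finally have "sdist M (Linf_sort L) f g \<le> d" .
    then have "K * sdist M (Linf_sort L) f g \<le> \<bar>K\<bar> * d"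
      by (intro mult_mono) auto
    with Ifun_dist[OF f g(1)] have "\<bar>Ifun L M f - Ifun L M g\<bar> \<le> \<bar>K\<bar> * d" by simp
    moreover have "\<bar>J f - J g\<bar> \<le> d * V"
      using P.integral_diff_le[OF integrable_P integrable_P, OF f g(1), of d]
        N.integral_diff_le[OF integrable_N integrable_N, OF f g(1), of d] close spaces
      by (simp add: J_def V_def distrib_left)
    ultimately have "\<bar>Ifun L M f - J f\<bar> \<le> d * (\<bar>K\<bar> + V)"
      using g(2) by (simp add: algebra_simps)
    with de show ?thesis by simp
  qed
  have "\<bar>Ifun L M f - J f\<bar> \<le> 0"
    by (rule field_le_epsilon, unfold add_0, rule bound)
  then show ?thesis by simp
qed

end

section \<open>The representation theorem for positive and for signed structures\<close>

theorem theorem4p7: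
  fixes L :: "('s,'f) integration_signature" and M :: "('s,'f,'a) metric_structure"
  assumes "is_integration_signature L"
  shows
    "(positive_integration_structure L M \<longrightarrow>
        (\<forall>f\<in>Linf L M.
           integrable (pos_loeb_measure L M) (\<lambda>\<omega>. ev L M f \<omega>) \<and>
           Ifun L M f = (\<integral>\<omega>. ev L M f \<omega> \<partial>pos_loeb_measure L M))) \<and>
     (signed_integration_structure L M \<longrightarrow>
        (\<forall>f\<in>Linf L M.
           signed_integrable (Om L M) (loeb_algebra L M) (signed_loeb_measure L M) (\<lambda>\<omega>. ev L M f \<omega>) \<and>
           Ifun L M f =
             signed_integral (Om L M) (loeb_algebra L M) (signed_loeb_measure L M) (\<lambda>\<omega>. ev L M f \<omega>)))"
proof (intro conjI impI ballI)
  have loeb_signature: "is_loeb_signature L"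
    using assms by (simp add: is_integration_signature_def)
  {
    fix f assume "positive_integration_structure L M" and f: "f \<in> Linf L M"
    then have sat: "saturated L M (cardSuc (card_sig L))" and base: "pre_integration_base L M"
      and loeb: "pre_loeb_finite_measure L M" and mu: "\<And>A. A \<in> Alg L M \<Longrightarrow> mu L M A = Ifun L M (chi L M A)"
      and lip: "lipschitz_linear_functional L M (pos_norm L M)"
      by (auto simp: positive_integration_structure_def positive_pre_integration_structure_def)
    interpret pre_integration L M
      using assms loeb_signature sat base loeb by unfold_locales (auto simp: pre_loeb_finite_measure_def)
    let ?P = "pos_loeb_measure L M"
    have P: "is_pos_loeb_measure L M ?P" by (rule pos_loeb_measure[OF loeb])
    have nonneg: "\<And>A. A \<in> Alg L M \<Longrightarrow> 0 \<le> mu L M A"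
      using loeb by (auto simp: pre_loeb_finite_measure_def)
    interpret P: finite_measure ?P
      using P by (intro finite_measureI) (auto simp: is_pos_loeb_measure_def)
    interpret N: finite_measure "null_measure ?P"
      by (intro finite_measureI) simp
    interpret charge_representation L M ?P "null_measure ?P" "pos_norm L M"
      using P mu lip nonneg
      by unfold_locales (auto simp: is_pos_loeb_measure_def measure_def)
    show "integrable ?P (\<lambda>\<omega>. ev L M f \<omega>)"
      using integrable_P[OF f] .
    show "Ifun L M f = (\<integral>\<omega>. ev L M f \<omega> \<partial>?P)"
      using Ifun_eq_J[OF f] by (simp add: J_def)
  next
    fix f assume "signed_integration_structure L M" and f: "f \<in> Linf L M"
    then have sat: "saturated L M (cardSuc (card_sig L))" and base: "pre_integration_base L M"
      and loeb: "pre_loeb_signed_measure L M" and mu: "\<And>A. A \<in> Alg L M \<Longrightarrow> mu L M A = Ifun L M (chi L M A)"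
      and lip: "lipschitz_linear_functional L M (signed_norm L M)"
      by (auto simp: signed_integration_structure_def signed_pre_integration_structure_def)
    interpret pre_integration L M
      using assms loeb_signature sat base loeb by unfold_locales (auto simp: pre_loeb_signed_measure_def)
    let ?\<nu> = "signed_loeb_measure L M"
    obtain P N where PN: "finite_measure P" "space P = Om L M" "sets P = loeb_algebra L M"
        "finite_measure N" "sets N = loeb_algebra L M"
        "\<And>E. E \<in> loeb_algebra L M \<Longrightarrow> ?\<nu> E = measure P E - measure N E"
      and \<nu>: "\<And>A. A \<in> Alg L M \<Longrightarrow> ?\<nu> (loeb_set L M A) = mu L M A"
      using signed_loeb_measure[OF loeb] by blast
    \<comment> \<open>The signed integral is defined by the Jordan parts, so these replace the pair
      \<open>P\<close>, \<open>N\<close>, which only serves to show that the Jordan parts are finite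
      measures with difference \<open>?\<nu>\<close>.\<close>
    note jordan = jordan_decomposition_diff[OF PN]
    interpret charge_representation L M "jordan_pos (Om L M) (loeb_algebra L M) ?\<nu>"
      "jordan_neg (Om L M) (loeb_algebra L M) ?\<nu>" "signed_norm L M"
    proof (intro charge_representation.intro charge_representation_axioms.intro)
      fix A assume A: "A \<in> Alg L M"
      show "mu L M A = measure (jordan_pos (Om L M) (loeb_algebra L M) ?\<nu>) (loeb_set L M A) -
          measure (jordan_neg (Om L M) (loeb_algebra L M) ?\<nu>) (loeb_set L M A)"
        using \<nu>[OF A] jordan(7)[OF _ loeb_set_in_loeb_algebra[OF A]] by simp
    qed (use jordan mu lip pre_integration_axioms in simp_all)
    show "signed_integrable (Om L M) (loeb_algebra L M) ?\<nu> (\<lambda>\<omega>. ev L M f \<omega>)"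
      using integrable_P[OF f] integrable_N[OF f] by (simp add: signed_integrable_def)
    show "Ifun L M f = signed_integral (Om L M) (loeb_algebra L M) ?\<nu> (\<lambda>\<omega>. ev L M f \<omega>)"
      using Ifun_eq_J[OF f] by (simp add: J_def signed_integral_def)
  }
qed

end
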